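(* Let $t\geq 2$ be an integer. Then for all sufficiently large $n$ (depending on $t$), $ex(n,H_{t,t})\leq 2^{16}\, t\, n^{\frac{4t}{2t+1}}$.
   Context: $ex(n,H)$ is the maximum number of edges in an $n$-vertex graph containing no subgraph isomorphic to $H$. For positive integers $s,t$, the graph $H_{s,t}$ is defined as follows: take an $s$-matching $x_1y_1,\dots,x_sy_s$ and a vertex-disjoint $t$-matching $x'_1y'_1,\dots,x'_ty'_t$, and add the edges $x_ix'_j$ and $y_iy'_j$ for all $i\in[s]$, $j\in[t]$. (So $H_{1,1}=C_4$ and $H_{2,2}$ is the 3-dimensional cube $Q_3$.) *)

theory Defs
  imports "HOL-Analysis.Analysis"
begin

type_synonym 'a graph = "'a set \<times> 'a set set"

abbreviation verts :: "'a graph \<Rightarrow> 'a set" where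
  "verts G \<equiv> fst G"

abbreviation edges :: "'a graph \<Rightarrow> 'a set set" where
  "edges G \<equiv> snd G"

definition simple_graph :: "'a graph \<Rightarrow> bool" where
  "simple_graph G \<longleftrightarrow> finite (verts G) \<and> (\<forall>e\<in>edges G. e \<subseteq> verts G \<and> card e = 2)"

definition subgraph :: "'a graph \<Rightarrow> 'a graph \<Rightarrow> bool" where
  "subgraph F G \<longleftrightarrow> simple_graph F \<and> verts F \<subseteq> verts G \<and> edges F \<subseteq> edges G"

definition graph_iso :: "'a graph \<Rightarrow> 'b graph \<Rightarrow> bool" where
  "graph_iso G H \<longleftrightarrow>
    (\<exists>f. bij_betw f (verts G) (verts H) \<and>
         (\<forall>u\<in>verts G. \<forall>v\<in>verts G. {u, v} \<in> edges G \<longleftrightarrow> {f u, f v} \<in> edges H))"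

definition contains_copy :: "'a graph \<Rightarrow> 'b graph \<Rightarrow> bool" where
  "contains_copy G H \<longleftrightarrow> (\<exists>F. subgraph F G \<and> graph_iso F H)"

text \<open>Since edge counts are invariant under isomorphism, it suffices to let the
  \<open>n\<close>-vertex graphs range over those whose vertices are natural numbers.  The set below is
  always finite, and it is nonempty as soon as \<open>H\<close> has an edge
  (lemmas \<open>finite_ex_set\<close> and \<open>ex_set_nonempty\<close>); if it is empty, the value of
  \<open>Max\<close> is unspecified.\<close>

definition ex_set :: "nat \<Rightarrow> 'b graph \<Rightarrow> nat set" where
  "ex_set n H = {card (edges G) | G :: nat graph.
     simple_graph G \<and> card (verts G) = n \<and> \<not> contains_copy G H}"

definition ex_number :: "nat \<Rightarrow> 'b graph \<Rightarrow> nat" where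
  "ex_number n H = Max (ex_set n H)"

text \<open>\<open>X' j\<close> and \<open>Y' j\<close> are the end points of the edges of the second matching.\<close>

datatype hvertex = X nat | Y nat | X' nat | Y' nat

definition H_graph :: "nat \<Rightarrow> nat \<Rightarrow> hvertex graph" where
  "H_graph s t =
    (X ` {1..s} \<union> Y ` {1..s} \<union> X' ` {1..t} \<union> Y' ` {1..t},
     {{X i, Y i} | i. i \<in> {1..s}} \<union>
     {{X' j, Y' j} | j. j \<in> {1..t}} \<union>
     {{X i, X' j} | i j. i \<in> {1..s} \<and> j \<in> {1..t}} \<union>
     {{Y i, Y' j} | i j. i \<in> {1..s} \<and> j \<in> {1..t}})"

lemma simple_graph_H_graph: "simple_graph (H_graph s t)"
  by (auto simp: simple_graph_def H_graph_def)

lemma card_edges_le: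
  assumes "simple_graph G"
  shows "card (edges G) \<le> 2 ^ card (verts G)"
proof -
  have "finite (verts G)" "edges G \<subseteq> Pow (verts G)"
    using assms by (auto simp: simple_graph_def)
  then show ?thesis
    by (metis card_Pow card_mono finite_Pow_iff)
qed

lemma finite_ex_set: "finite (ex_set n H)"
  by (rule finite_subset[of _ "{..2 ^ n}"]) (auto simp: ex_set_def dest: card_edges_le)

lemma ex_set_nonempty:
  assumes "simple_graph H" "edges H \<noteq> {}"
  shows "ex_set n H \<noteq> {}"
proof -
  let ?G = "({..<n}, {}) :: nat graph"
  obtain u v where uv: "{u, v} \<in> edges H" "u \<in> verts H" "v \<in> verts H"
    using assms by (fastforce simp: simple_graph_def card_2_iff)
  have "\<not> contains_copy ?G H"
  proof
    assume "contains_copy ?G H"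
    then obtain F :: "nat graph" and f where F: "edges F = {}" "bij_betw f (verts F) (verts H)"
      "\<forall>a\<in>verts F. \<forall>b\<in>verts F. {a, b} \<in> edges F \<longleftrightarrow> {f a, f b} \<in> edges H"
      by (auto simp: contains_copy_def subgraph_def graph_iso_def)
    obtain a b where "a \<in> verts F" "b \<in> verts F" "f a = u" "f b = v"
      using F(2) uv(2,3) by (metis bij_betw_imp_surj_on imageE)
    then show False
      using F uv(1) by auto
  qed
  moreover have "simple_graph ?G" "card (verts ?G) = n"
    by (auto simp: simple_graph_def)
  ultimately show ?thesis
    unfolding ex_set_def by blast
qed

end

theory Submission
  imports Defs
begin

text \<open>Removing \<open>X'\<^sub>2, \<dots>, X'\<^sub>t\<close> and \<open>Y'\<^sub>1, Y'\<^sub>3, \<dots>, Y'\<^sub>t\<close> from \<open>H\<^sub>t\<^sub>,\<^sub>t\<close> leaves the theta graph formed by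
  the \<open>t\<close> paths \<open>X'\<^sub>1, X\<^sub>i, Y\<^sub>i, Y'\<^sub>2\<close>, whose bipartite Turan number is \<open>O((ab)\<^bsup>2/3\<^esup> + a + b)\<close>.  So one
  chooses \<open>t - 2\<close> edges \<open>Y'\<^sub>jX'\<^sub>j\<close> and the two vertices \<open>X'\<^sub>2\<close>, \<open>Y'\<^sub>1\<close>, and looks for the theta graph
  between the common neighbourhood \<open>P\<close> of the chosen \<open>X'\<^sub>j\<close> and the common neighbourhood \<open>Q\<close> of the chosen
  \<open>Y'\<^sub>j\<close>.  Summed over all choices, the edges between \<open>P\<close> and \<open>Q\<close> are counted from below
  through 4-cycles, and the theta bound \<open>(|P||Q|)\<^bsup>2/3\<^esup>\<close> has to be beaten on average.

  Because the two ends of a chosen edge are dependent, \<open>|P|\<close> and \<open>|Q|\<close> have to be decoupled.  This is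
  achieved without any regularisation: pass to the bipartite subgraph maximising
  \<open>e / (|A||B|)\<^bsup>g\<^esup>\<close> with \<open>g = (2t-1)/(2t+1)\<close>.  Maximality bounds the number of edges inside every
  \<open>U \<times> V\<close>.  Since \<open>g > 2/3\<close> for \<open>t \<ge> 3\<close>, splitting into dyadic levels upgrades this to
  \<open>\<Sum>\<^bsub>uv \<in> E\<^esub> (\<phi>(u) \<psi>(v))\<^bsup>2/3\<^esup> \<le> c e (mean \<phi> mean \<psi>)\<^bsup>2/3\<^esup>\<close>, which tensorises to tuples of edges.
  For \<open>t = 2\<close> there are no chosen edges and nothing to decouple.  The value of \<open>g\<close> is the
  largest one for which the maximal subgraph cannot degenerate to a star.\<close>

section \<open>Theta graphs in bipartite graphs\<close>

lemma card_sum_Image: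
  assumes "finite U" "finite V" "E \<subseteq> U \<times> V"
  shows "card E = (\<Sum>u\<in>U. card (E `` {u}))"
proof -
  have "E = (SIGMA u:U. E `` {u})" using assms by auto
  moreover have "\<forall>u\<in>U. finite (E `` {u})"
    using assms by (meson finite_Image finite_SigmaI finite_subset)
  ultimately show ?thesis using assms(1) by (metis card_SigmaI)
qed

lemma card_sum_converse_Image:
  assumes "finite U" "finite V" "E \<subseteq> U \<times> V"
  shows "card E = (\<Sum>v\<in>V. card (E\<inverse> `` {v}))"
proof -
  have "card E = card (E\<inverse>)" by (simp add: card_inverse)
  also have "\<dots> = (\<Sum>v\<in>V. card (E\<inverse> `` {v}))"
    by (rule card_sum_Image[OF assms(2,1)]) (use assms in auto)
  finally show ?thesis .
qed

text \<open>Take a pair of vertex sets of least total size that still satisfies the edge inequality.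
  Deleting a vertex whose degree is at most its threshold lowers the right side at least as much as
  the left and keeps the inequality, against minimality.\<close>

lemma min_degree_subgraph:
  fixes \<alpha> \<beta> :: real
  assumes fin: "finite U" "finite V" and sub: "E \<subseteq> U \<times> V" and nn: "\<alpha> \<ge> 0" "\<beta> \<ge> 0"
    and big: "real (card E) > \<alpha> * real (card U) + \<beta> * real (card V)"
  obtains U' V' where "U' \<subseteq> U" "V' \<subseteq> V" "E \<inter> U' \<times> V' \<noteq> {}"
    "\<And>u. u \<in> U' \<Longrightarrow> real (card ((E \<inter> U' \<times> V') `` {u})) > \<alpha>"
    "\<And>v. v \<in> V' \<Longrightarrow> real (card ((E \<inter> U' \<times> V')\<inverse> `` {v})) > \<beta>"
proof -
  define good where "good W \<longleftrightarrow> fst W \<subseteq> U \<and> snd W \<subseteq> V \<and>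
    real (card (E \<inter> fst W \<times> snd W)) > \<alpha> * real (card (fst W)) + \<beta> * real (card (snd W))" for W
  have "E \<inter> U \<times> V = E" using sub by auto
  then have "good (U, V)" using big by (auto simp: good_def)
  then obtain W where W: "good W"
    and min: "\<And>W'. good W' \<Longrightarrow> card (fst W) + card (snd W) \<le> card (fst W') + card (snd W')"
    using ex_has_least_nat[of good "(U, V)" "\<lambda>W. card (fst W) + card (snd W)"] by blast
  obtain U' V' where UV: "W = (U', V')" by (cases W)
  let ?E = "E \<inter> U' \<times> V'"
  have sub': "U' \<subseteq> U" "V' \<subseteq> V" and big': "real (card ?E) > \<alpha> * real (card U') + \<beta> * real (card V')"
    using W by (auto simp: good_def UV)
  have fin': "finite U'" "finite V'" using sub' fin by (auto intro: finite_subset)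
  have finE: "finite ?E" using fin' by auto
  have ne: "?E \<noteq> {}"
  proof
    assume "?E = {}"
    moreover have "\<alpha> * real (card U') \<ge> 0" "\<beta> * real (card V') \<ge> 0" using nn by auto
    ultimately show False using big' by simp
  qed
  moreover have "real (card (?E `` {u})) > \<alpha>" if u: "u \<in> U'" for u
  proof (rule ccontr)
    assume a: "\<not> ?thesis"
    have "\<not> good (U' - {u}, V')"
      using min[of "(U' - {u}, V')"] card_Diff1_less[OF fin'(1) u] by (auto simp: UV)
    then have 1: "real (card (E \<inter> (U' - {u}) \<times> V')) \<le> \<alpha> * real (card (U' - {u})) + \<beta> * real (card V')"
      using sub' by (auto simp: good_def)
    have "?E = E \<inter> (U' - {u}) \<times> V' \<union> {u} \<times> (?E `` {u})" using u by auto
    then have "card ?E \<le> card (E \<inter> (U' - {u}) \<times> V') + card ({u} \<times> (?E `` {u}))"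
      by (metis card_Un_le)
    then have "real (card ?E) \<le> real (card (E \<inter> (U' - {u}) \<times> V')) + real (card (?E `` {u}))"
      by (simp add: card_cartesian_product)
    moreover have "real (card U') = real (card (U' - {u})) + 1"
      using u fin' by (metis card_Suc_Diff1 of_nat_Suc add.commute)
    ultimately show False using a 1 big' by (simp add: algebra_simps)
  qed
  moreover have "real (card (?E\<inverse> `` {v})) > \<beta>" if v: "v \<in> V'" for v
  proof (rule ccontr)
    assume a: "\<not> ?thesis"
    have "\<not> good (U', V' - {v})"
      using min[of "(U', V' - {v})"] card_Diff1_less[OF fin'(2) v] by (auto simp: UV)
    then have 1: "real (card (E \<inter> U' \<times> (V' - {v}))) \<le> \<alpha> * real (card U') + \<beta> * real (card (V' - {v}))"
      using sub' by (auto simp: good_def)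
    have "?E = E \<inter> U' \<times> (V' - {v}) \<union> (?E\<inverse> `` {v}) \<times> {v}" using v by auto
    then have "card ?E \<le> card (E \<inter> U' \<times> (V' - {v})) + card ((?E\<inverse> `` {v}) \<times> {v})"
      by (metis card_Un_le)
    then have "real (card ?E) \<le> real (card (E \<inter> U' \<times> (V' - {v}))) + real (card (?E\<inverse> `` {v}))"
      by (simp add: card_cartesian_product)
    moreover have "real (card V') = real (card (V' - {v})) + 1"
      using v fin' by (metis card_Suc_Diff1 of_nat_Suc add.commute)
    ultimately show False using a 1 big' by (simp add: algebra_simps)
  qed
  ultimately show ?thesis using that sub' by blast
qed

text \<open>\<open>t\<close> internally disjoint paths of length three between \<open>y0\<close> and \<open>x0\<close>, with middle edges \<open>zs\<close>.\<close>

definition theta :: "nat \<Rightarrow> ('a \<times> 'b) set \<Rightarrow> bool" where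
  "theta t E \<longleftrightarrow> (\<exists>x0 y0 zs. length zs = t \<and> set zs \<subseteq> E \<and>
     distinct (x0 # map fst zs) \<and> distinct (y0 # map snd zs) \<and>
     (\<forall>z\<in>set zs. (fst z, y0) \<in> E \<and> (x0, snd z) \<in> E))"

lemma theta_mono: "theta t E \<Longrightarrow> E \<subseteq> F \<Longrightarrow> theta t F"
  unfolding theta_def by (elim exE, intro exI) auto

lemma theta_converse:
  assumes "theta t (E\<inverse>)" shows "theta t E"
proof -
  obtain y0 x0 zs where "length zs = t" "set zs \<subseteq> E\<inverse>" "distinct (y0 # map fst zs)"
    "distinct (x0 # map snd zs)" "\<forall>z\<in>set zs. (fst z, x0) \<in> E\<inverse> \<and> (y0, snd z) \<in> E\<inverse>"
    using assms unfolding theta_def by blast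
  then show ?thesis
    unfolding theta_def
    by (intro exI[of _ x0] exI[of _ y0] exI[of _ "map prod.swap zs"]) (auto simp: o_def)
qed

lemma card_greater_imp_ex:
  assumes "card Z < card S" "finite Z"
  obtains y where "y \<in> S" "y \<notin> Z"
  using assms by (meson card_mono leD subsetI)

text \<open>Since all of \<open>L\<close> is joined to \<open>y0\<close>, a theta graph only needs
  \<open>t\<close> disjoint edges between \<open>L\<close> and \<open>W\<close> whose ends in
  \<open>W\<close> are neighbours of one further vertex \<open>x0\<close> of \<open>L\<close>.
  Inside a subgraph of minimum degree above \<open>t\<close> they are found greedily: a fresh
  neighbour \<open>y\<close> of \<open>x0\<close>, then a fresh neighbour \<open>x\<close> of
  \<open>y\<close>.\<close>

lemma theta_of_rooted:
  assumes fin: "finite L" "finite W" and L: "\<And>x. x \<in> L \<Longrightarrow> (x, y0) \<in> E" and y0: "y0 \<notin> W"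
    and big: "card (E \<inter> L \<times> W) > t * (card L + card W)"
  shows "theta t E"
proof -
  let ?F = "E \<inter> L \<times> W"
  have "real (card ?F) > real (t * (card L + card W))" using big by (simp only: of_nat_less_iff)
  then have "real (card ?F) > real t * real (card L) + real t * real (card W)"
    by (simp add: algebra_simps)
  then obtain L' W' where "L' \<subseteq> L" "W' \<subseteq> W" and ne: "?F \<inter> L' \<times> W' \<noteq> {}"
    and d1: "\<And>u. u \<in> L' \<Longrightarrow> real (card ((?F \<inter> L' \<times> W') `` {u})) > real t"
    and d2: "\<And>v. v \<in> W' \<Longrightarrow> real (card ((?F \<inter> L' \<times> W')\<inverse> `` {v})) > real t"
    using min_degree_subgraph[of L W ?F "real t" "real t"] fin by auto
  let ?G = "?F \<inter> L' \<times> W'"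
  obtain x0 where x0: "x0 \<in> L'" using ne by auto
  have "\<exists>zs. length zs = k \<and> set zs \<subseteq> ?G \<and> distinct (x0 # map fst zs) \<and> distinct (map snd zs) \<and>
      (\<forall>z\<in>set zs. (x0, snd z) \<in> ?G)" if "k \<le> t" for k
    using that
  proof (induction k)
    case 0 then show ?case by auto
  next
    case (Suc k)
    then obtain zs where zs: "length zs = k" "set zs \<subseteq> ?G" "distinct (x0 # map fst zs)"
      "distinct (map snd zs)" "\<forall>z\<in>set zs. (x0, snd z) \<in> ?G" by auto
    have "card (snd ` set zs) \<le> k" using card_length[of "map snd zs"] zs(1) by simp
    then obtain y where y: "y \<in> ?G `` {x0}" "y \<notin> snd ` set zs"
      using d1[OF x0] Suc.prems card_greater_imp_ex[of "snd ` set zs" "?G `` {x0}"] by auto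
    then have "y \<in> W'" by auto
    \<comment> \<open>At most \<open>k + 1 \<le> t\<close> vertices are forbidden for
      \<open>x\<close>: those already used and \<open>x0\<close>.\<close>
    have "card (insert x0 (fst ` set zs)) \<le> Suc k"
      using card_length[of "x0 # map fst zs"] zs(1) by simp
    then obtain x where x: "x \<in> ?G\<inverse> `` {y}" "x \<notin> insert x0 (fst ` set zs)"
      using d2[OF \<open>y \<in> W'\<close>] Suc.prems
        card_greater_imp_ex[of "insert x0 (fst ` set zs)" "?G\<inverse> `` {y}"] by auto
    show ?case
      by (rule exI[of _ "(x, y) # zs"]) (use x y zs in auto)
  qed
  then obtain zs where zs: "length zs = t" "set zs \<subseteq> ?G" "distinct (x0 # map fst zs)"
    "distinct (map snd zs)" "\<forall>z\<in>set zs. (x0, snd z) \<in> ?G" by blast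
  have "\<forall>z\<in>set zs. (fst z, y0) \<in> E \<and> (x0, snd z) \<in> E" using zs(2,5) L by auto
  moreover have "y0 \<notin> set (map snd zs)" using zs(2) y0 by auto
  ultimately show ?thesis
    unfolding theta_def
    by (intro exI[of _ x0] exI[of _ y0] exI[of _ zs] conjI) (use zs in auto)
qed

lemma ex_large_fibre:
  assumes "finite S" "S \<noteq> {}" "card (p ` S) \<le> t"
  obtains b where "b \<in> p ` S" "card S \<le> t * card {y \<in> S. p y = b}"
proof -
  let ?f = "\<lambda>b. card {y \<in> S. p y = b}"
  have "Max (?f ` p ` S) \<in> ?f ` p ` S" using assms by (intro Max_in) auto
  then obtain b where b: "b \<in> p ` S" "?f b = Max (?f ` p ` S)" by (metis (lifting) imageE)
  have "card S = (\<Sum>b\<in>p ` S. ?f b)"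
    using sum.group[of S "p ` S" p "\<lambda>_. 1::nat"] assms(1) by simp
  also have "\<dots> \<le> card (p ` S) * ?f b"
  proof -
    have "?f c \<le> ?f b" if "c \<in> p ` S" for c
      unfolding b(2) using that assms(1) by (intro Max_ge) auto
    then show ?thesis using sum_bounded_above[of "p ` S" ?f "?f b"] by simp
  qed
  also have "\<dots> \<le> t * ?f b" using assms(3) by simp
  finally show ?thesis using that b by blast
qed

text \<open>One \<open>y\<close> for each of \<open>t\<close> distinct values of \<open>p\<close>
  gives \<open>t\<close> internally disjoint paths \<open>y0\<close>, \<open>p y\<close>,
  \<open>y\<close>, \<open>x0\<close>. In use, \<open>p\<close> maps a second-level vertex to its
  parent in the search tree.\<close>

lemma card_parents_of_theta_free:
  assumes nt: "\<not> theta t E" and fin: "finite S"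
    and S: "\<And>y. y \<in> S \<Longrightarrow> (x0, y) \<in> E \<and> (p y, y) \<in> E \<and> (p y, y0) \<in> E \<and> p y \<noteq> x0 \<and> y \<noteq> y0"
  shows "card (p ` S) < t"
proof (rule ccontr)
  assume "\<not> card (p ` S) < t"
  then obtain Z where Z: "Z \<subseteq> p ` S" "card Z = t" by (meson not_less obtain_subset_with_card_n)
  then obtain Y0 where Y0: "Y0 \<subseteq> S" "inj_on p Y0" "p ` Y0 = Z" by (auto simp: subset_image_inj)
  then obtain ys where ys: "set ys = Y0" "distinct ys"
    using fin finite_distinct_list finite_subset by metis
  have "length ys = t" using ys Y0 Z by (metis card_image distinct_card)
  moreover have "distinct (map p ys)" using ys Y0 by (simp add: distinct_map)
  ultimately have "theta t E"
    unfolding theta_def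
    by (intro exI[of _ x0] exI[of _ y0] exI[of _ "map (\<lambda>y. (p y, y)) ys"])
       (use ys Y0 S in \<open>auto simp: o_def\<close>)
  then show False using nt by simp
qed

lemma cube_root_bound:
  fixes e c m :: real
  assumes "0 \<le> e" "0 \<le> c" "0 \<le> m" "e ^ 3 \<le> c ^ 3 * m ^ 2"
  shows "e \<le> c * m powr (2/3)"
proof -
  have "(m powr (2/3)) ^ 3 = m ^ 2"
    using assms(3) by (cases "m = 0") (simp_all add: powr_power)
  then have "e ^ 3 \<le> (c * m powr (2/3)) ^ 3" using assms(4) by (simp add: power_mult_distrib)
  then show ?thesis using assms(2) power_le_imp_le_base[of e 2 "c * m powr (2/3)"]
    by (simp add: eval_nat_numeral)
qed

lemma card_le_Suc_card_Diff: "card S \<le> Suc (card (S - {y}))"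
  by (cases "finite S") (auto simp: card_Diff_singleton_if)

text \<open>Breadth-first search from \<open>y0\<close>: in a theta-free graph the edges between consecutive levels are
  sparse compared with the vertices they meet, so the levels grow by factors of the order of the
  minimum degrees.  For the third level, every vertex sees fewer than \<open>t\<close> subtrees hanging off
  the first level, and is assigned to the one it sees most.\<close>

lemma theta_free_min_degree:
  fixes \<alpha> \<beta> :: real
  assumes nt: "\<not> theta t E" and t: "t \<ge> 1"
    and fin: "finite U" "finite V" and sub: "E \<subseteq> U \<times> V" and ne: "E \<noteq> {}"
    and d1: "\<And>u. u \<in> U \<Longrightarrow> real (card (E `` {u})) > \<alpha>"
    and d2: "\<And>v. v \<in> V \<Longrightarrow> real (card (E\<inverse> `` {v})) > \<beta>"
    and \<alpha>: "\<alpha> \<ge> 4 * real t ^ 2" and \<beta>: "\<beta> \<ge> 4 * real t ^ 2"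
  shows "\<alpha> * \<beta> ^ 2 \<le> 4 * real t ^ 3 * real (card U)"
proof -
  obtain y0 where y0: "y0 \<in> V" using ne sub by auto
  define L1 where "L1 = E\<inverse> `` {y0}"
  define L2 where "L2 = E `` L1 - {y0}"
  have L1: "L1 \<subseteq> U" using sub by (auto simp: L1_def)
  have L2: "L2 \<subseteq> V" using sub by (auto simp: L2_def)
  have fL: "finite L1" "finite L2" using L1 L2 fin finite_subset by blast+
  have cL1: "real (card L1) > \<beta>" using d2[OF y0] by (simp add: L1_def)
  have t1: "1 \<le> real t" "real t \<le> real t ^ 2" "1 \<le> real t ^ 2"
    using t by (auto simp: self_le_power)
  \<comment> \<open>A vertex of \<open>L1\<close> loses at most the neighbour
    \<open>y0\<close>.\<close>
  have "real (card L1) * (\<alpha> - 1) \<le> real (card (E \<inter> L1 \<times> L2))"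
  proof -
    have "card (E \<inter> L1 \<times> L2) = (\<Sum>x\<in>L1. card ((E \<inter> L1 \<times> L2) `` {x}))"
      by (rule card_sum_Image[OF fL(1) fL(2)]) auto
    moreover have "real (card ((E \<inter> L1 \<times> L2) `` {x})) \<ge> \<alpha> - 1" if "x \<in> L1" for x
    proof -
      have "(E \<inter> L1 \<times> L2) `` {x} = E `` {x} - {y0}" using that by (auto simp: L2_def)
      moreover have "real (card (E `` {x})) > \<alpha>" using d1 that L1 by auto
      ultimately show ?thesis using card_le_Suc_card_Diff[of "E `` {x}" y0] by simp
    qed
    ultimately show ?thesis
      using sum_mono[of L1 "\<lambda>_. \<alpha> - 1" "\<lambda>x. real (card ((E \<inter> L1 \<times> L2) `` {x}))"] by simp
  qed
  moreover have "card (E \<inter> L1 \<times> L2) \<le> t * (card L1 + card L2)"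
    using theta_of_rooted[OF fL(1) fL(2), of y0 E t] nt by (force simp: L1_def L2_def)
  then have "real (card (E \<inter> L1 \<times> L2)) \<le> real t * (real (card L1) + real (card L2))"
    by (metis of_nat_add of_nat_le_iff of_nat_mult)
  ultimately have "real (card L1) * (\<alpha> - 1 - real t) \<le> real t * real (card L2)"
    by (simp add: algebra_simps)
  \<comment> \<open>Here \<open>\<alpha> / 2 \<ge> 2 * t^2 \<ge> t + 1\<close> absorbs the
    lower-order terms.\<close>
  moreover have "real (card L1) * (\<alpha> / 2) \<le> real (card L1) * (\<alpha> - 1 - real t)"
    using \<alpha> t1 by (intro mult_left_mono) (linarith | simp)+
  ultimately have A: "real (card L1) * \<alpha> \<le> 2 * real t * real (card L2)" by simp

  define p where "p y = (SOME x. x \<in> L1 \<and> (x, y) \<in> E)" for y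
  have p: "p y \<in> L1 \<and> (p y, y) \<in> E" if "y \<in> L2" for y
    unfolding p_def by (rule someI_ex) (use that in \<open>auto simp: L2_def\<close>)
  \<comment> \<open>\<open>Ew\<close> drops from the edges at \<open>L2\<close> only the tree edge
    from each \<open>y\<close> to its parent, so it keeps at least \<open>\<beta> - 1\<close> edges
    at every \<open>y\<close>.\<close>
  define Ew where "Ew = {(x, y) \<in> E. y \<in> L2 \<and> p y \<noteq> x}"
  have Ew: "Ew \<subseteq> U \<times> L2" using sub by (auto simp: Ew_def)
  have "real (card L2) * (\<beta> - 1) \<le> real (card Ew)"
  proof -
    have "card Ew = (\<Sum>y\<in>L2. card (Ew\<inverse> `` {y}))"
      by (rule card_sum_converse_Image[OF fin(1) fL(2) Ew])
    moreover have "real (card (Ew\<inverse> `` {y})) \<ge> \<beta> - 1" if "y \<in> L2" for y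
    proof -
      have "Ew\<inverse> `` {y} = E\<inverse> `` {y} - {p y}" using that by (auto simp: Ew_def)
      moreover have "real (card (E\<inverse> `` {y})) > \<beta>" using d2 that L2 by auto
      ultimately show ?thesis using card_le_Suc_card_Diff[of "E\<inverse> `` {y}" "p y"] by simp
    qed
    ultimately show ?thesis
      using sum_mono[of L2 "\<lambda>_. \<beta> - 1" "\<lambda>x. real (card (Ew\<inverse> `` {x}))"] by simp
  qed
  moreover have "card Ew \<le> t * (t * (card U + card L2))"
  proof -
    have "\<exists>b. b \<in> p ` (Ew `` {x}) \<and> card (Ew `` {x}) \<le> t * card {y \<in> Ew `` {x}. p y = b}"
      if "Ew `` {x} \<noteq> {}" for x
    proof -
      have f: "finite (Ew `` {x})" using Ew fL by (meson finite_Image finite_SigmaI finite_subset fin(1))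
      have "card (p ` (Ew `` {x})) < t"
        by (rule card_parents_of_theta_free[OF nt f, of x _ y0])
           (use p in \<open>auto simp: Ew_def L2_def L1_def\<close>)
      then show ?thesis
        using ex_large_fibre[OF f that, of p t] by (metis less_imp_le)
    qed
    then obtain b where b: "\<And>x. Ew `` {x} \<noteq> {} \<Longrightarrow> b x \<in> p ` (Ew `` {x})"
      "\<And>x. Ew `` {x} \<noteq> {} \<Longrightarrow> card (Ew `` {x}) \<le> t * card {y \<in> Ew `` {x}. p y = b x}"
      by metis
    \<comment> \<open>The edges kept by the choice of \<open>b\<close> are sorted into blocks by the
      common parent \<open>c\<close>. Each block is rooted at \<open>c\<close>, which is adjacent to
      all of \<open>Bb c\<close> and lies outside \<open>Ub c\<close>. The blocks are disjoint on
      both sides, so their sizes add up to at most \<open>card U + card L2\<close>. One factor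
      \<open>t\<close> comes from the choice of \<open>b\<close>, the other from the rooted
      bound.\<close>
    define Ub where "Ub c = {x \<in> U. Ew `` {x} \<noteq> {} \<and> b x = c}" for c
    define Bb where "Bb c = {y \<in> L2. p y = c}" for c
    have fUB: "finite (Ub c)" "finite (Bb c)" for c using fin fL by (auto simp: Ub_def Bb_def)
    have rooted: "card (E \<inter> Ub c \<times> Bb c) \<le> t * (card (Ub c) + card (Bb c))" for c
    proof (rule ccontr)
      assume a: "\<not> ?thesis"
      have "(E \<inter> Ub c \<times> Bb c)\<inverse> = E\<inverse> \<inter> Bb c \<times> Ub c" by auto
      then have eq: "card (E \<inter> Ub c \<times> Bb c) = card (E\<inverse> \<inter> Bb c \<times> Ub c)" by (metis card_inverse)
      have "theta t (E\<inverse>)"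
      proof (rule theta_of_rooted[where L = "Bb c" and W = "Ub c" and ?y0.0 = c])
        show "(x, c) \<in> E\<inverse>" if "x \<in> Bb c" for x using that p by (auto simp: Bb_def)
        show "c \<notin> Ub c" using b(1)[of c] by (fastforce simp: Ub_def Ew_def)
      qed (use fUB a eq in \<open>auto simp: add.commute\<close>)
      then show False using nt theta_converse by blast
    qed
    have "card Ew = (\<Sum>x\<in>U. card (Ew `` {x}))" by (rule card_sum_Image[OF fin(1) fL(2) Ew])
    also have "\<dots> = (\<Sum>x\<in>{x\<in>U. Ew `` {x} \<noteq> {}}. card (Ew `` {x}))"
      by (rule sum.mono_neutral_right) (use fin in auto)
    also have "\<dots> \<le> (\<Sum>x\<in>{x\<in>U. Ew `` {x} \<noteq> {}}. t * card {y \<in> Ew `` {x}. p y = b x})"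
      by (rule sum_mono) (use b in auto)
    also have "\<dots> = t * (\<Sum>x\<in>{x\<in>U. Ew `` {x} \<noteq> {}}. card {y \<in> Ew `` {x}. p y = b x})"
      by (simp add: sum_distrib_left)
    also have "(\<Sum>x\<in>{x\<in>U. Ew `` {x} \<noteq> {}}. card {y \<in> Ew `` {x}. p y = b x})
       = (\<Sum>c\<in>L1. \<Sum>x\<in>Ub c. card {y \<in> Ew `` {x}. p y = b x})"
    proof -
      have "b ` {x\<in>U. Ew `` {x} \<noteq> {}} \<subseteq> L1" using b(1) p by (fastforce simp: Ew_def)
      from sum.group[OF _ fL(1) this, of "\<lambda>x. card {y \<in> Ew `` {x}. p y = b x}"]
      show ?thesis using fin by (simp add: Ub_def conj_assoc)
    qed
    also have "\<dots> \<le> (\<Sum>c\<in>L1. card (E \<inter> Ub c \<times> Bb c))"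
    proof (rule sum_mono)
      fix c
      have "(\<Sum>x\<in>Ub c. card {y \<in> Ew `` {x}. p y = b x}) \<le> (\<Sum>x\<in>Ub c. card ((E \<inter> Ub c \<times> Bb c) `` {x}))"
      proof (intro sum_mono card_mono)
        fix x assume "x \<in> Ub c"
        then show "{y \<in> Ew `` {x}. p y = b x} \<subseteq> (E \<inter> Ub c \<times> Bb c) `` {x}"
          by (auto simp: Ew_def Bb_def Ub_def)
      qed (use fUB in \<open>auto intro: finite_Image\<close>)
      also have "\<dots> = card (E \<inter> Ub c \<times> Bb c)"
        using card_sum_Image[OF fUB(1)[of c] fUB(2)[of c], of "E \<inter> Ub c \<times> Bb c"] by simp
      finally show "(\<Sum>x\<in>Ub c. card {y \<in> Ew `` {x}. p y = b x}) \<le> card (E \<inter> Ub c \<times> Bb c)" .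
    qed
    also have "\<dots> \<le> (\<Sum>c\<in>L1. t * (card (Ub c) + card (Bb c)))" by (rule sum_mono) (rule rooted)
    also have "\<dots> = t * ((\<Sum>c\<in>L1. card (Ub c)) + (\<Sum>c\<in>L1. card (Bb c)))"
      by (simp only: sum_distrib_left[symmetric] sum.distrib)
    also have "(\<Sum>c\<in>L1. card (Ub c)) = card (\<Union>c\<in>L1. Ub c)"
      by (rule card_UN_disjoint[symmetric]) (use fL fUB in \<open>auto simp: Ub_def\<close>)
    also have "(\<Sum>c\<in>L1. card (Bb c)) = card (\<Union>c\<in>L1. Bb c)"
      by (rule card_UN_disjoint[symmetric]) (use fL fUB in \<open>auto simp: Bb_def\<close>)
    also have "card (\<Union>c\<in>L1. Ub c) + card (\<Union>c\<in>L1. Bb c) \<le> card U + card L2"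
      by (intro add_mono card_mono) (use fin fL L2 in \<open>auto simp: Ub_def Bb_def\<close>)
    finally show ?thesis by simp
  qed
  then have "real (card Ew) \<le> real t ^ 2 * (real (card U) + real (card L2))"
    by (metis (no_types, opaque_lifting) of_nat_add of_nat_le_iff of_nat_mult mult.assoc power2_eq_square)
  ultimately have "real (card L2) * (\<beta> - 1 - real t ^ 2) \<le> real t ^ 2 * real (card U)"
    by (simp add: algebra_simps)
  moreover have "real (card L2) * (\<beta> / 2) \<le> real (card L2) * (\<beta> - 1 - real t ^ 2)"
    using \<beta> t1 by (intro mult_left_mono) (linarith | simp)+
  ultimately have B: "real (card L2) * \<beta> \<le> 2 * real t ^ 2 * real (card U)" by simp
  have b0: "\<beta> \<ge> 0" "\<alpha> \<ge> 0" using \<alpha> \<beta> t1 by linarith+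
  have "\<alpha> * \<beta> ^ 2 = \<beta> * \<alpha> * \<beta>" by (simp add: power2_eq_square)
  also have "\<dots> \<le> real (card L1) * \<alpha> * \<beta>" using cL1 b0 by (intro mult_right_mono) auto
  also have "\<dots> \<le> 2 * real t * real (card L2) * \<beta>" using A b0 by (intro mult_right_mono) auto
  also have "\<dots> = 2 * real t * (real (card L2) * \<beta>)" by simp
  also have "\<dots> \<le> 2 * real t * (2 * real t ^ 2 * real (card U))" using B by (intro mult_left_mono) auto
  finally show ?thesis by (simp add: power2_eq_square power3_eq_cube)
qed

text \<open>The thresholds \<open>e / (4 * u)\<close> and \<open>e / (4 * v)\<close> use up only
  half of the \<open>e\<close> edges, so a subgraph with these minimum degrees exists. The linear
  term makes both exceed \<open>4 * t^2\<close>; the minimum degree bound then reads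
  \<open>e^3 \<le> 256 * t^3 * (u * v)^2\<close>, and \<open>256 \<le> 8^3\<close>.\<close>

lemma theta_free_card_le:
  assumes nt: "\<not> theta t E" and t: "t \<ge> 1" and fin: "finite U" "finite V" and sub: "E \<subseteq> U \<times> V"
  shows "real (card E) \<le> 8 * real t * (real (card U) * real (card V)) powr (2/3)
           + 16 * real t ^ 2 * (real (card U) + real (card V))"
proof (rule ccontr)
  assume a: "\<not> ?thesis"
  define e u v where "e = real (card E)" and "u = real (card U)" and "v = real (card V)"
  have big: "e > 8 * real t * (u * v) powr (2/3)" "e > 16 * real t ^ 2 * u" "e > 16 * real t ^ 2 * v" "e > 0"
    and nn: "u \<ge> 0" "v \<ge> 0"
  proof -
    have "8 * real t * (u * v) powr (2/3) \<ge> 0" "16 * real t ^ 2 * u \<ge> 0" "16 * real t ^ 2 * v \<ge> 0"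
      by (auto simp: u_def v_def)
    then show "e > 8 * real t * (u * v) powr (2/3)" "e > 16 * real t ^ 2 * u" "e > 16 * real t ^ 2 * v" "e > 0"
      using a unfolding e_def u_def v_def distrib_left by linarith+
  qed (auto simp: u_def v_def)
  have ne: "E \<noteq> {}" using big by (auto simp: e_def)
  then have uv: "u > 0" "v > 0" using sub fin by (auto simp: u_def v_def card_gt_0_iff)
  have "real (card E) > (e / (4 * u)) * real (card U) + (e / (4 * v)) * real (card V)"
    using uv big by (simp add: e_def u_def v_def)
  then obtain U' V' where UV: "U' \<subseteq> U" "V' \<subseteq> V" "E \<inter> U' \<times> V' \<noteq> {}"
    and d1: "\<And>x. x \<in> U' \<Longrightarrow> real (card ((E \<inter> U' \<times> V') `` {x})) > e / (4 * u)"
    and d2: "\<And>y. y \<in> V' \<Longrightarrow> real (card ((E \<inter> U' \<times> V')\<inverse> `` {y})) > e / (4 * v)"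
    using min_degree_subgraph[OF fin sub, of "e / (4 * u)" "e / (4 * v)"] uv big by auto
  have "(e / (4 * u)) * (e / (4 * v)) ^ 2 \<le> 4 * real t ^ 3 * real (card U')"
  proof (rule theta_free_min_degree[OF _ t _ _ _ UV(3) d1 d2])
    show "\<not> theta t (E \<inter> U' \<times> V')" using nt theta_mono by blast
    show "finite U'" "finite V'" using UV fin finite_subset by auto
  qed (use uv big in \<open>auto simp: field_simps\<close>)
  also have "\<dots> \<le> 4 * real t ^ 3 * u"
    using card_mono[OF fin(1) UV(1)] by (intro mult_left_mono) (auto simp: u_def)
  finally have "e ^ 3 \<le> 256 * real t ^ 3 * (u * v) ^ 2"
    using uv by (simp add: field_simps power2_eq_square power3_eq_cube)
  also have "\<dots> \<le> (8 * real t) ^ 3 * (u * v) ^ 2"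
    by (intro mult_right_mono) (auto simp: power_mult_distrib)
  finally have "e \<le> 8 * real t * (u * v) powr (2/3)"
    using big nn by (intro cube_root_bound) auto
  then show False using big by simp
qed

section \<open>Extremal subgraphs\<close>

text \<open>The term of the least \<open>k\<close> with \<open>x \<le> 2 ^ k\<close> alone suffices.
  Stating the bound as a sum of indicators lets later sums be exchanged into sizes of level
  sets.\<close>

lemma dyadic_bound:
  fixes x s :: real
  assumes "0 \<le> x" "x \<le> 2 ^ I" "0 \<le> s"
  shows "x powr s \<le> (\<Sum>i\<le>I. 2 powr (real i * s) * of_bool (i = 0 \<or> x > 2 ^ (i - 1)))"
proof -
  define k where "k = (LEAST i. x \<le> 2 ^ i)"
  have k: "x \<le> 2 ^ k" "k \<le> I" using assms(2) unfolding k_def by (auto intro: LeastI Least_le)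
  have "k = 0 \<or> x > 2 ^ (k - 1)"
    using not_less_Least[of "k - 1" "\<lambda>i. x \<le> 2 ^ i"] by (cases k) (auto simp: k_def)
  then have "(2::real) powr (real k * s) = 2 powr (real k * s) * of_bool (k = 0 \<or> x > 2 ^ (k - 1))" by simp
  also have "\<dots> \<le> (\<Sum>i\<le>I. 2 powr (real i * s) * of_bool (i = 0 \<or> x > 2 ^ (i - 1)))"
    using k(2) by (intro member_le_sum) auto
  finally have "(2::real) powr (real k * s) \<le> (\<Sum>i\<le>I. 2 powr (real i * s) * of_bool (i = 0 \<or> x > 2 ^ (i - 1)))" .
  moreover have "x powr s \<le> (2 ^ k) powr s" using assms k by (intro powr_mono2) auto
  moreover have "((2::real) ^ k) powr s = 2 powr (real k * s)"
    by (simp add: powr_powr flip: powr_realpow)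
  ultimately show ?thesis by linarith
qed

lemma sum_geometric_le:
  fixes z :: real assumes "0 \<le> z" "z < 1" shows "(\<Sum>i\<le>I. z ^ i) \<le> 1 / (1 - z)"
  using assms by (auto simp: sum_gp0 intro!: divide_right_mono)

text \<open>The last conjunct is the maximality of \<open>e(U, V) / (|U| |V|)^g\<close> at
  \<open>(A, B)\<close>, multiplied out. In this form an empty \<open>U\<close> or \<open>V\<close>
  is harmless, both sides being 0.\<close>

definition extremal :: "real \<Rightarrow> ('a \<times> 'b) set \<Rightarrow> 'a set \<Rightarrow> 'b set \<Rightarrow> bool" where
  "extremal g E A B \<longleftrightarrow> finite A \<and> finite B \<and> A \<noteq> {} \<and> B \<noteq> {} \<and> E \<subseteq> A \<times> B \<and> E \<noteq> {} \<and>
     (\<forall>U\<subseteq>A. \<forall>V\<subseteq>B. real (card (E \<inter> U \<times> V)) \<le>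
        real (card E) * (real (card U) / real (card A)) powr g * (real (card V) / real (card B)) powr g)"

lemma card_converse_Int_Times: "card (E\<inverse> \<inter> V \<times> U) = card (E \<inter> U \<times> V)"
proof -
  have "E\<inverse> \<inter> V \<times> U = (E \<inter> U \<times> V)\<inverse>" by auto
  then show ?thesis by (metis card_inverse)
qed

lemma extremal_converse:
  assumes "extremal g E A B" shows "extremal g (E\<inverse>) B A"
  using assms unfolding extremal_def card_converse_Int_Times card_inverse
  by (auto simp: mult_ac)

lemma extremalD:
  assumes "extremal g E A B"
  shows "finite A" "finite B" "E \<subseteq> A \<times> B" "finite E" "card A > 0" "card B > 0" "card E > 0"
proof -
  show "finite A" "finite B" "E \<subseteq> A \<times> B" using assms by (auto simp: extremal_def)
  then show "finite E" using finite_subset by blast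
  then show "card A > 0" "card B > 0" "card E > 0" using assms by (auto simp: extremal_def card_gt_0_iff)
qed

lemma extremal_le:
  assumes "extremal g E A B" "U \<subseteq> A" "V \<subseteq> B"
  shows "real (card (E \<inter> U \<times> V)) \<le>
    real (card E) * (real (card U) / real (card A)) powr g * (real (card V) / real (card B)) powr g"
  using assms by (simp add: extremal_def)

text \<open>Weighted AM-GM for \<open>x\<close> and 1: the concave power lies below its tangent at
  1.\<close>

lemma powr_le_tangent:
  fixes x g :: real
  assumes "0 \<le> x" "0 \<le> g" "g \<le> 1"
  shows "x powr g \<le> 1 + g * (x - 1)"
proof (cases "x = 0")
  case True then show ?thesis using assms by simp
next
  case False
  then show ?thesis
    using Youngs_inequality_0[of g "1 - g" x 1] assms by (simp add: algebra_simps)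
qed

text \<open>Removing \<open>u\<close> loses exactly its degree, and extremality forces the loss to
  be at least a fraction \<open>1 - (1 - 1/|A|)^g \<ge> g / |A|\<close> of the edges.\<close>

lemma extremal_min_degree:
  assumes ex: "extremal g E A B" and g: "0 \<le> g" "g \<le> 1" and u: "u \<in> A"
  shows "g * real (card E) / real (card A) \<le> real (card (E `` {u}))"
proof -
  note D = extremalD[OF ex]
  let ?a = "real (card A)" and ?e = "real (card E)"
  have cA: "real (card (A - {u})) = ?a - 1" using D u by (simp add: of_nat_diff)
  have "E = E \<inter> (A - {u}) \<times> B \<union> {u} \<times> (E `` {u})" using D by auto
  then have "card E \<le> card (E \<inter> (A - {u}) \<times> B) + card ({u} \<times> (E `` {u}))" by (metis card_Un_le)
  then have "?e \<le> real (card (E \<inter> (A - {u}) \<times> B)) + real (card (E `` {u}))"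
    by (simp add: card_cartesian_product)
  also have "real (card (E \<inter> (A - {u}) \<times> B)) \<le> ?e * ((?a - 1) / ?a) powr g"
    using extremal_le[OF ex, of "A - {u}" B] D(6) cA by (auto simp: card_gt_0_iff)
  also have "\<dots> \<le> ?e * (1 + g * ((?a - 1) / ?a - 1))"
    using D g by (intro mult_left_mono powr_le_tangent) auto
  also have "(?a - 1) / ?a - 1 = - 1 / ?a" using D(5) by (simp add: diff_divide_distrib card_gt_0_iff)
  finally show ?thesis by (simp add: algebra_simps)
qed

text \<open>\<open>5/7\<close> is the exponent for \<open>t = 3\<close>, the smallest
  \<open>t\<close> with chosen edges. With \<open>y = 2 powr (g - 2/3)\<close> and
  \<open>w = 2 powr (2/3)\<close> the left side equals \<open>w * y^2 / (y - 1)\<close>, where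
  \<open>w \<le> 1.6\<close> and \<open>y\<close> lies in \<open>[1.033, 1.26]\<close>.\<close>

lemma level_weight_bound:
  fixes g :: real
  assumes "5 / 7 \<le> g" "g \<le> 1"
  shows "2 powr g / (1 - 2 powr (2/3 - g)) \<le> 53"
proof -
  define y where "y = 2 powr (g - 2/3)"
  define w :: real where "w = 2 powr (2/3)"
  have w: "w ^ 3 = 4" "w > 0" by (simp_all add: w_def powr_power)
  have w16: "w \<le> (8/5)" using w power_le_imp_le_base[of w 2 "8/5"] by (simp add: eval_nat_numeral)
  have "y \<ge> 2 powr (1/21)" unfolding y_def using assms by (intro powr_mono) auto
  moreover have "(1033/1000::real) \<le> 2 powr (1/21)"
    using power_le_imp_le_base[of "1033/1000::real" 20 "2 powr (1/21)"]
    by (simp add: powr_power) (simp add: eval_nat_numeral)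
  ultimately have y1: "y \<ge> (1033/1000)" by linarith
  have "y \<le> 2 powr (1/3)" unfolding y_def using assms by (intro powr_mono) auto
  moreover have "2 powr (1/3) \<le> (63/50::real)"
    using power_le_imp_le_base[of "2 powr (1/3)" 2 "63/50::real"]
    by (simp add: powr_power) (simp add: eval_nat_numeral)
  ultimately have y2: "y \<le> (63/50)" by linarith
  \<comment> \<open>On this interval the convex \<open>y^2\<close> lies below its chord, and the
    chord lies below \<open>33 * (y - 1)\<close>.\<close>
  have "(y - (1033/1000)) * ((63/50) - y) \<ge> 0" using y1 y2 by simp
  moreover have "(y - (1033/1000)) * ((63/50) - y) = (2293/1000) * y - y * y - 130158/100000"
    by (simp add: field_simps)
  ultimately have "0 \<le> (2293/1000) * y - y * y - 130158/100000" by (simp only:)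
  then have "y * y \<le> 33 * (y - 1)" using y1 by argo
  then have "w * (y * y) \<le> (8/5) * (33 * (y - 1))" using mult_mono[OF w16 \<open>y * y \<le> 33 * (y - 1)\<close>] y1 by simp
  also have "\<dots> \<le> 53 * (y - 1)" using y1 by simp
  finally have "w * (y * y) \<le> 53 * (y - 1)" .
  moreover have "2 powr g = w * y" by (simp add: w_def y_def flip: powr_add)
  moreover have "2 powr (2/3 - g) = 1 / y" by (simp add: y_def powr_diff)
  ultimately have "2 powr g / (1 - 2 powr (2/3 - g)) = (w * y) / (1 - 1 / y)" by (simp only:)
  also have "\<dots> = w * (y * y) / (y - 1)" using y1 by (simp add: field_simps)
  also have "\<dots> \<le> 53" using \<open>w * (y * y) \<le> 53 * (y - 1)\<close> y1 by (simp add: divide_le_eq)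
  finally show ?thesis .
qed

text \<open>\<open>U i\<close> consists of the vertices where \<open>\<phi>\<close> exceeds
  \<open>2^(i-1)\<close> times its mean, and is all of \<open>A\<close> for \<open>i = 0\<close>. By
  Markov's inequality its density is at most \<open>2 * 2^-i\<close>, so the weighted sum is
  dominated by a geometric series of ratio \<open>2 powr (2/3 - g)\<close>, which is below 1 because
  \<open>g > 2/3\<close>.\<close>

lemma levels:
  fixes \<phi> :: "'a \<Rightarrow> real"
  assumes fin: "finite A" "A \<noteq> {}" and nn: "\<And>u. u \<in> A \<Longrightarrow> 0 \<le> \<phi> u"
    and c: "c = (\<Sum>u\<in>A. \<phi> u) / real (card A)" "c > 0" and g: "5/7 \<le> g" "g \<le> 1"
  obtains U and I :: nat where "\<And>i. U i \<subseteq> A"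
    "\<And>u. u \<in> A \<Longrightarrow> (\<phi> u / c) powr (2/3) \<le> (\<Sum>i\<le>I. 2 powr (real i * (2/3)) * of_bool (u \<in> U i))"
    "(\<Sum>i\<le>I. 2 powr (real i * (2/3)) * (real (card (U i)) / real (card A)) powr g) \<le> 53"
proof -
  let ?a = "real (card A)"
  have a: "?a > 0" using fin by (simp add: card_gt_0_iff)
  define U where "U i = {u\<in>A. i = 0 \<or> \<phi> u / c > 2 ^ (i - 1)}" for i :: nat
  obtain I :: nat where I: "(\<Sum>u\<in>A. \<phi> u) / c < 2 ^ I"
    using real_arch_pow[of 2 "(\<Sum>u\<in>A. \<phi> u) / c"] by auto
  have nnc: "0 \<le> \<phi> u / c" if "u \<in> A" for u using nn[OF that] c(2) by simp
  have le: "\<phi> u / c \<le> 2 ^ I" if "u \<in> A" for u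
  proof -
    have "\<phi> u \<le> (\<Sum>u\<in>A. \<phi> u)" using that fin nn by (intro member_le_sum) auto
    then have "\<phi> u / c \<le> (\<Sum>u\<in>A. \<phi> u) / c" using c by (intro divide_right_mono) auto
    then show ?thesis using I by linarith
  qed
  have "(\<phi> u / c) powr (2/3) \<le> (\<Sum>i\<le>I. 2 powr (real i * (2/3)) * of_bool (u \<in> U i))" if "u \<in> A" for u
    using dyadic_bound[OF nnc[OF that] le[OF that], of "2/3"] that
    by (simp add: U_def)
  moreover have "(\<Sum>i\<le>I. 2 powr (real i * (2/3)) * (real (card (U i)) / ?a) powr g) \<le> 53"
  proof -
    have size: "real (card (U i)) / ?a \<le> 2 * (1/2) ^ i" for i
    proof (cases i)
      case 0
      have "card (U i) \<le> card A" using fin by (intro card_mono) (auto simp: U_def)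
      then show ?thesis using a 0 by (simp add: field_simps)
    next
      case (Suc j)
      have "2 ^ j * real (card (U i)) = (\<Sum>u\<in>U i. 2 ^ j)" by simp
      also have "\<dots> \<le> (\<Sum>u\<in>U i. \<phi> u / c)" by (intro sum_mono) (auto simp: U_def Suc)
      also have "\<dots> \<le> (\<Sum>u\<in>A. \<phi> u / c)" using fin by (intro sum_mono2) (auto simp: U_def intro: nnc)
      also have "\<dots> = (\<Sum>u\<in>A. \<phi> u) / c" by (rule sum_divide_distrib[symmetric])
      also have "\<dots> = ?a" using c a by (auto simp: field_simps)
      finally show ?thesis using a Suc by (simp add: field_simps power_divide)
    qed
    let ?z = "2 powr (2/3 - g)"
    have "2 powr (real i * (2/3)) * (real (card (U i)) / ?a) powr g \<le> 2 powr g * ?z ^ i" for i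
    proof -
      have "(real (card (U i)) / ?a) powr g \<le> (2 * (1/2) ^ i) powr g"
        using size g by (intro powr_mono2) auto
      also have "\<dots> = 2 powr g * 2 powr (- real i * g)"
      proof -
        have "2 * (1/2) ^ i = (2::real) powr (1 - real i)"
          by (simp add: powr_diff powr_realpow power_divide)
        then show ?thesis by (simp add: powr_powr algebra_simps flip: powr_add)
      qed
      finally have "2 powr (real i * (2/3)) * (real (card (U i)) / ?a) powr g
        \<le> 2 powr (real i * (2/3)) * (2 powr g * 2 powr (- real i * g))"
        by (intro mult_left_mono) auto
      also have "\<dots> = 2 powr g * ?z ^ i"
        by (simp add: powr_power algebra_simps flip: powr_add)
      finally show ?thesis .
    qed
    then have "(\<Sum>i\<le>I. 2 powr (real i * (2/3)) * (real (card (U i)) / ?a) powr g)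
        \<le> (\<Sum>i\<le>I. 2 powr g * ?z ^ i)" by (rule sum_mono)
    also have "\<dots> \<le> 2 powr g * (1 / (1 - ?z))"
      unfolding sum_distrib_left[symmetric] using g
      by (intro mult_left_mono sum_geometric_le) (auto simp: powr_less_one)
    also have "\<dots> \<le> 53" using level_weight_bound[OF g] by simp
    finally show ?thesis .
  qed
  moreover have "U i \<subseteq> A" for i by (auto simp: U_def)
  ultimately show ?thesis using that by blast
qed

text \<open>The constant is \<open>2809 = 53\<^sup>2\<close>, one factor 53 from the dyadic levels of each side.\<close>

lemma sum_edges_powr_le:
  fixes \<phi> :: "'a \<Rightarrow> real" and \<psi> :: "'b \<Rightarrow> real"
  assumes ex: "extremal g E A B" and g: "5/7 \<le> g" "g \<le> 1"
    and nn: "\<And>u. u \<in> A \<Longrightarrow> 0 \<le> \<phi> u" "\<And>v. v \<in> B \<Longrightarrow> 0 \<le> \<psi> v"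
  shows "(\<Sum>(u, v)\<in>E. (\<phi> u * \<psi> v) powr (2/3)) \<le> 2809 * real (card E) *
    (((\<Sum>u\<in>A. \<phi> u) / real (card A)) * ((\<Sum>v\<in>B. \<psi> v) / real (card B))) powr (2/3)"
proof -
  note D = extremalD[OF ex]
  have ne: "A \<noteq> {}" "B \<noteq> {}" using D by auto
  define c d where "c = (\<Sum>u\<in>A. \<phi> u) / real (card A)" and "d = (\<Sum>v\<in>B. \<psi> v) / real (card B)"
  have cd: "c \<ge> 0" "d \<ge> 0" unfolding c_def d_def using nn by (auto intro!: divide_nonneg_nonneg sum_nonneg)
  show ?thesis
  proof (cases "c > 0 \<and> d > 0")
    \<comment> \<open>A zero mean forces a nonnegative function to vanish, and with it the left
      side.\<close>
    case False
    then have "c = 0 \<or> d = 0" using cd by auto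
    then have "(\<Sum>u\<in>A. \<phi> u) = 0 \<or> (\<Sum>v\<in>B. \<psi> v) = 0" using D(5,6) by (auto simp: c_def d_def)
    then have "(\<forall>u\<in>A. \<phi> u = 0) \<or> (\<forall>v\<in>B. \<psi> v = 0)"
      using nn D by (simp add: sum_nonneg_eq_0_iff)
    then have "(\<Sum>(u, v)\<in>E. (\<phi> u * \<psi> v) powr (2/3)) = 0"
      using D(3) by (intro sum.neutral) auto
    then show ?thesis by simp
  next
    case True
    then have pos: "c > 0" "d > 0" by auto
    let ?\<alpha> = "\<lambda>i::nat. (2::real) powr (real i * (2/3))"
    obtain U and I :: nat where U: "\<And>i. U i \<subseteq> A"
      "\<And>u. u \<in> A \<Longrightarrow> (\<phi> u / c) powr (2/3) \<le> (\<Sum>i\<le>I. ?\<alpha> i * of_bool (u \<in> U i))"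
      "(\<Sum>i\<le>I. ?\<alpha> i * (real (card (U i)) / real (card A)) powr g) \<le> 53"
      by (rule levels[OF D(1) ne(1) nn(1) c_def pos(1) g], assumption) (rule that)
    obtain V and J :: nat where V: "\<And>i. V i \<subseteq> B"
      "\<And>v. v \<in> B \<Longrightarrow> (\<psi> v / d) powr (2/3) \<le> (\<Sum>j\<le>J. ?\<alpha> j * of_bool (v \<in> V j))"
      "(\<Sum>j\<le>J. ?\<alpha> j * (real (card (V j)) / real (card B)) powr g) \<le> 53"
      by (rule levels[OF D(2) ne(2) nn(2) d_def pos(2) g], assumption) (rule that)
    let ?e = "real (card E)"
    let ?u = "\<lambda>i. (real (card (U i)) / real (card A)) powr g"
    let ?v = "\<lambda>j. (real (card (V j)) / real (card B)) powr g"
    have eq: "(\<Sum>(u, v)\<in>E. (\<phi> u * \<psi> v) powr (2/3))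
        = (c * d) powr (2/3) * (\<Sum>(u, v)\<in>E. (\<phi> u / c) powr (2/3) * (\<psi> v / d) powr (2/3))"
    proof -
      have "(\<phi> u * \<psi> v) powr (2/3) = (c * d) powr (2/3) * ((\<phi> u / c) powr (2/3) * (\<psi> v / d) powr (2/3))"
        if "(u, v) \<in> E" for u v
      proof -
        have "0 \<le> \<phi> u / c" "0 \<le> \<psi> v / d" using that D(3) nn pos by auto
        then have "(c * d) powr (2/3) * ((\<phi> u / c) powr (2/3) * (\<psi> v / d) powr (2/3))
            = ((c * d) * ((\<phi> u / c) * (\<psi> v / d))) powr (2/3)"
          using pos by (simp only: powr_mult)
        then show ?thesis using pos by simp
      qed
      then show ?thesis unfolding sum_distrib_left by (intro sum.cong) auto
    qed
    have "(\<Sum>(u, v)\<in>E. (\<phi> u / c) powr (2/3) * (\<psi> v / d) powr (2/3))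
       \<le> (\<Sum>(u, v)\<in>E. (\<Sum>i\<le>I. ?\<alpha> i * of_bool (u \<in> U i)) * (\<Sum>j\<le>J. ?\<alpha> j * of_bool (v \<in> V j)))"
    proof (intro sum_mono, clarify)
      fix u v assume "(u, v) \<in> E"
      then have "u \<in> A" "v \<in> B" using D(3) by auto
      then show "(\<phi> u / c) powr (2/3) * (\<psi> v / d) powr (2/3)
          \<le> (\<Sum>i\<le>I. ?\<alpha> i * of_bool (u \<in> U i)) * (\<Sum>j\<le>J. ?\<alpha> j * of_bool (v \<in> V j))"
        by (intro mult_mono U(2) V(2) sum_nonneg) auto
    qed
    \<comment> \<open>Exchanging the sums turns the indicators into the numbers of edges in
      \<open>U i \<times> V j\<close>. Extremality bounds these by products, and the double sum
      factors into one sum per side.\<close>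
    also have "\<dots> = (\<Sum>z\<in>E. \<Sum>i\<le>I. \<Sum>j\<le>J. ?\<alpha> i * ?\<alpha> j * of_bool (z \<in> U i \<times> V j))"
      unfolding case_prod_unfold sum_product mem_Times_iff of_bool_conj
      by (intro sum.cong refl) (simp only: mult_ac)
    also have "\<dots> = (\<Sum>i\<le>I. \<Sum>j\<le>J. \<Sum>z\<in>E. ?\<alpha> i * ?\<alpha> j * of_bool (z \<in> U i \<times> V j))"
      by (subst sum.swap, intro sum.cong refl, subst sum.swap, rule refl)
    also have "\<dots> = (\<Sum>i\<le>I. \<Sum>j\<le>J. ?\<alpha> i * ?\<alpha> j * real (card (E \<inter> U i \<times> V j)))"
      using D(4) by (intro sum.cong refl) (simp add: Int_def flip: sum_distrib_left)
    also have "\<dots> \<le> (\<Sum>i\<le>I. \<Sum>j\<le>J. ?\<alpha> i * ?\<alpha> j * (?e * ?u i * ?v j))"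
      by (intro sum_mono mult_left_mono extremal_le[OF ex] U V) auto
    also have "\<dots> = ?e * ((\<Sum>i\<le>I. ?\<alpha> i * ?u i) * (\<Sum>j\<le>J. ?\<alpha> j * ?v j))"
      unfolding sum_product unfolding sum_distrib_left by (intro sum.cong refl) (simp only: mult_ac)
    also have "\<dots> \<le> ?e * (53 * 53)"
      by (intro mult_left_mono mult_mono U V sum_nonneg) auto
    finally have "(c * d) powr (2/3) * (\<Sum>(u, v)\<in>E. (\<phi> u / c) powr (2/3) * (\<psi> v / d) powr (2/3))
      \<le> (c * d) powr (2/3) * (?e * (53 * 53))" by (intro mult_left_mono) auto
    then show ?thesis unfolding eq by (simp add: c_def d_def mult_ac)
  qed
qed

text \<open>High degrees are rare. If a fraction \<open>\<rho>\<close> of \<open>A\<close> has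
  degree above \<open>2^j\<close> times the mean, extremality against all of \<open>B\<close> gives
  \<open>2^j * \<rho> \<le> \<rho> powr g\<close>, and the bound on \<open>g\<close> turns this into
  \<open>2^(j * (k + 1)) * \<rho> \<le> 1\<close>. This decay beats the weight
  \<open>2^(i * k)\<close> of level \<open>i = j + 1\<close> and leaves a geometric series of ratio
  \<open>1/2\<close>.\<close>

lemma sum_degree_power_le:
  assumes ex: "extremal g E A B" and g: "1 - 1 / real (Suc k) \<le> g"
  shows "(\<Sum>u\<in>A. real (card (E `` {u})) ^ k) \<le> 2 ^ (k + 2) * real (card A) * (real (card E) / real (card A)) ^ k"
proof -
  note D = extremalD[OF ex]
  let ?a = "real (card A)" and ?e = "real (card E)" and ?d = "\<lambda>u. real (card (E `` {u}))"
  define c where "c = ?e / ?a"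
  have c: "c > 0" using D by (simp add: c_def)
  obtain I :: nat where I: "?e / c < 2 ^ I" using real_arch_pow[of 2 "?e / c"] by auto
  define U where "U i = {u\<in>A. i = 0 \<or> ?d u / c > 2 ^ (i - 1)}" for i :: nat
  have sumd: "?e = (\<Sum>u\<in>A. ?d u)" using card_sum_Image[OF D(1-3)] by simp
  have "(?d u / c) ^ k \<le> (\<Sum>i\<le>I. 2 ^ (i * k) * of_bool (u \<in> U i))" if "u \<in> A" for u
  proof -
    have "?d u \<le> ?e" unfolding sumd using that D by (intro member_le_sum) auto
    then have "?d u / c \<le> ?e / c" using c by (intro divide_right_mono) auto
    then have le: "?d u / c \<le> 2 ^ I" using I by linarith
    have "(?d u / c) ^ k \<le> (\<Sum>i\<le>I. 2 powr (real i * real k) * of_bool (u \<in> U i))"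
    proof (cases "k = 0 \<or> ?d u = 0")
      \<comment> \<open>\<open>0 ^ 0\<close> is 1 whereas \<open>0 powr 0\<close> is 0, so these
        cases are settled by level 0 alone.\<close>
      case True
      have "(?d u / c) ^ k \<le> 1" using True by (auto simp: power_0_left)
      also have "1 = 2 powr (real 0 * real k) * of_bool (u \<in> U 0)" using that by (simp add: U_def)
      also have "\<dots> \<le> (\<Sum>i\<le>I. 2 powr (real i * real k) * of_bool (u \<in> U i))"
        by (rule member_le_sum) auto
      finally show ?thesis .
    next
      case False
      then have "(?d u / c) ^ k = (?d u / c) powr real k" using c by (simp add: powr_realpow)
      also have "\<dots> \<le> (\<Sum>i\<le>I. 2 powr (real i * real k) * of_bool (u \<in> U i))"
        using dyadic_bound[of "?d u / c" I "real k"] le c that by (simp add: U_def)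
      finally show ?thesis .
    qed
    also have "\<dots> = (\<Sum>i\<le>I. 2 ^ (i * k) * of_bool (u \<in> U i))"
      by (intro sum.cong refl) (simp flip: powr_realpow)
    finally show ?thesis .
  qed
  then have "(\<Sum>u\<in>A. (?d u / c) ^ k) \<le> (\<Sum>u\<in>A. \<Sum>i\<le>I. 2 ^ (i * k) * of_bool (u \<in> U i))"
    by (rule sum_mono)
  also have "\<dots> = (\<Sum>i\<le>I. 2 ^ (i * k) * real (card (U i)))"
    by (subst sum.swap, intro sum.cong refl) (use D in \<open>simp add: U_def Int_def flip: sum_distrib_left\<close>)
  also have "\<dots> \<le> (\<Sum>i\<le>I. ?a * 2 ^ (k + 1) * (1/2) ^ i)"
  proof (rule sum_mono)
    fix i
    define \<rho> where "\<rho> = real (card (U i)) / ?a"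
    have "card (U i) \<le> card A" using D by (intro card_mono) (auto simp: U_def)
    then have \<rho>: "0 \<le> \<rho>" "\<rho> \<le> 1" "real (card (U i)) = ?a * \<rho>" using D by (auto simp: \<rho>_def)
    have "2 ^ (i * k) * \<rho> \<le> 2 ^ (k + 1) * (1/2) ^ i"
    proof (cases "i = 0 \<or> \<rho> = 0")
      case True
      moreover have "(1::real) \<le> 2 ^ (k + 1)" by (rule one_le_power) simp
      ultimately show ?thesis using \<rho> by auto
    next
      case False
      then obtain j where j: "i = Suc j" by (cases i) auto
      have "2 ^ j * c * real (card (U i)) = (\<Sum>u\<in>U i. 2 ^ j * c)" by simp
      also have "\<dots> \<le> (\<Sum>u\<in>U i. real (card ((E \<inter> U i \<times> B) `` {u})))"
      proof (rule sum_mono)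
        fix u assume u: "u \<in> U i"
        then have "(E \<inter> U i \<times> B) `` {u} = E `` {u}" using D by auto
        then show "2 ^ j * c \<le> real (card ((E \<inter> U i \<times> B) `` {u}))"
          using u c by (simp add: U_def j field_simps)
      qed
      also have "\<dots> = real (card (E \<inter> U i \<times> B))"
        using card_sum_Image[of "U i" B "E \<inter> U i \<times> B"] D by (simp add: U_def)
      also have "\<dots> \<le> ?e * \<rho> powr g"
        using extremal_le[OF ex, of "U i" B] D(6) by (auto simp: U_def \<rho>_def card_gt_0_iff)
      finally have "2 ^ j * \<rho> \<le> \<rho> powr g"
        using D(5,7) by (simp add: \<rho>(3) c_def field_simps card_gt_0_iff)
      also have "\<dots> \<le> \<rho> powr (1 - 1 / real (Suc k))"
        using \<rho> False g by (intro powr_mono') auto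
      also have "\<dots> = \<rho> / \<rho> powr (1 / real (Suc k))" using \<rho> False by (simp add: powr_diff)
      finally have "2 ^ j * \<rho> powr (1 / real (Suc k)) \<le> 1" using \<rho> False by (simp add: field_simps)
      then have "(2 ^ j * \<rho> powr (1 / real (Suc k))) ^ Suc k \<le> 1"
        using power_le_one[of "2 ^ j * \<rho> powr (1 / real (Suc k))" "Suc k"] by auto
      moreover have "(\<rho> powr (1 / real (Suc k))) ^ Suc k = \<rho>"
        using \<rho> False by (simp add: powr_power del: power_Suc of_nat_Suc)
      ultimately have "2 ^ (j * Suc k) * \<rho> \<le> 1" by (simp only: power_mult_distrib power_mult)
      then show ?thesis by (simp add: j field_simps power_add power_divide)
    qed
    then have "?a * (2 ^ (i * k) * \<rho>) \<le> ?a * (2 ^ (k + 1) * (1/2) ^ i)"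
      by (intro mult_left_mono) auto
    then show "2 ^ (i * k) * real (card (U i)) \<le> ?a * 2 ^ (k + 1) * (1/2) ^ i"
      by (simp only: \<rho>(3)) (simp add: mult_ac)
  qed
  also have "\<dots> = ?a * 2 ^ (k + 1) * (\<Sum>i\<le>I. (1/2) ^ i)" by (simp add: sum_distrib_left)
  also have "\<dots> \<le> ?a * 2 ^ (k + 1) * (1 / (1 - 1/2))"
    by (intro mult_left_mono sum_geometric_le) auto
  finally have "(\<Sum>u\<in>A. (?d u / c) ^ k) \<le> ?a * 2 ^ (k + 2)" by simp
  then show ?thesis using c by (simp add: power_divide c_def[symmetric] field_simps flip: sum_divide_distrib)
qed

section \<open>Sums over tuples of edges\<close>

definition tuples :: "'a set \<Rightarrow> nat \<Rightarrow> 'a list set" where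
  "tuples S r = {xs. set xs \<subseteq> S \<and> length xs = r}"

lemma finite_tuples: "finite S \<Longrightarrow> finite (tuples S r)"
  unfolding tuples_def by (rule finite_lists_length_eq)

lemma card_tuples: "finite S \<Longrightarrow> card (tuples S r) = card S ^ r"
  unfolding tuples_def by (rule card_lists_length_eq)

lemma tuples_0 [simp]: "tuples S 0 = {[]}"
  by (auto simp: tuples_def)

lemma sum_tuples_Suc:
  fixes f :: "'a list \<Rightarrow> 'b::comm_monoid_add"
  shows "(\<Sum>xs\<in>tuples S (Suc r). f xs) = (\<Sum>x\<in>S. \<Sum>xs\<in>tuples S r. f (x # xs))"
proof -
  have "tuples S (Suc r) = (\<lambda>(x, xs). x # xs) ` (S \<times> tuples S r)"
    by (auto simp: tuples_def length_Suc_conv image_iff)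
  moreover have "inj_on (\<lambda>(x, xs). x # xs) (S \<times> tuples S r)" by (auto simp: inj_on_def)
  ultimately have "(\<Sum>xs\<in>tuples S (Suc r). f xs) = (\<Sum>(x, xs)\<in>S \<times> tuples S r. f (x # xs))"
    by (simp add: sum.reindex case_prod_unfold o_def)
  then show ?thesis by (simp add: sum.cartesian_product)
qed

text \<open>Induction works because the exponent \<open>2/3\<close> is the same on both sides: the inner sums are again
  weight functions for the single-edge inequality.\<close>

lemma sum_edge_tuples_powr_le:
  fixes \<phi> :: "'a list \<Rightarrow> real" and \<psi> :: "'b list \<Rightarrow> real"
  assumes ex: "extremal g E A B" and g: "r = 0 \<or> 5/7 \<le> g" "g \<le> 1"
    and nn: "\<And>T. 0 \<le> \<phi> T" "\<And>S. 0 \<le> \<psi> S"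
  shows "(\<Sum>F\<in>tuples E r. (\<phi> (map fst F) * \<psi> (map snd F)) powr (2/3)) \<le> (2809 * real (card E)) ^ r *
    (((\<Sum>T\<in>tuples A r. \<phi> T) / real (card A) ^ r) * ((\<Sum>S\<in>tuples B r. \<psi> S) / real (card B) ^ r)) powr (2/3)"
  using g(1) nn
proof (induction r arbitrary: \<phi> \<psi>)
  case 0
  then show ?case by simp
next
  case (Suc r)
  note D = extremalD[OF ex]
  let ?N = "2809 * real (card E)" and ?a = "real (card A)" and ?b = "real (card B)"
  define \<Phi> where "\<Phi> u = (\<Sum>T\<in>tuples A r. \<phi> (u # T)) / ?a ^ r" for u
  define \<Psi> where "\<Psi> v = (\<Sum>S\<in>tuples B r. \<psi> (v # S)) / ?b ^ r" for v
  have nn': "0 \<le> \<Phi> u" "0 \<le> \<Psi> v" for u v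
    unfolding \<Phi>_def \<Psi>_def using Suc.prems by (auto intro!: divide_nonneg_nonneg sum_nonneg)
  have "(\<Sum>F\<in>tuples E (Suc r). (\<phi> (map fst F) * \<psi> (map snd F)) powr (2/3))
     = (\<Sum>(u, v)\<in>E. \<Sum>F\<in>tuples E r. (\<phi> (u # map fst F) * \<psi> (v # map snd F)) powr (2/3))"
    by (simp add: sum_tuples_Suc case_prod_unfold)
  also have "\<dots> \<le> (\<Sum>(u, v)\<in>E. ?N ^ r * (\<Phi> u * \<Psi> v) powr (2/3))"
  proof (intro sum_mono, clarify)
    fix u v
    show "(\<Sum>F\<in>tuples E r. (\<phi> (u # map fst F) * \<psi> (v # map snd F)) powr (2/3)) \<le> ?N ^ r * (\<Phi> u * \<Psi> v) powr (2/3)"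
      unfolding \<Phi>_def \<Psi>_def by (rule Suc.IH) (use Suc.prems in auto)
  qed
  also have "\<dots> = ?N ^ r * (\<Sum>(u, v)\<in>E. (\<Phi> u * \<Psi> v) powr (2/3))"
    by (simp add: sum_distrib_left case_prod_unfold)
  also have "\<dots> \<le> ?N ^ r * (?N * (((\<Sum>u\<in>A. \<Phi> u) / ?a) * ((\<Sum>v\<in>B. \<Psi> v) / ?b)) powr (2/3))"
    using sum_edges_powr_le[OF ex _ g(2), of \<Phi> \<Psi>] nn' Suc.prems(1) by (intro mult_left_mono) auto
  also have "(\<Sum>u\<in>A. \<Phi> u) / ?a = (\<Sum>T\<in>tuples A (Suc r). \<phi> T) / ?a ^ Suc r"
    unfolding \<Phi>_def by (simp add: sum_tuples_Suc flip: sum_divide_distrib)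
  also have "(\<Sum>v\<in>B. \<Psi> v) / ?b = (\<Sum>S\<in>tuples B (Suc r). \<psi> S) / ?b ^ Suc r"
    unfolding \<Psi>_def by (simp add: sum_tuples_Suc flip: sum_divide_distrib)
  finally show ?case by (simp add: mult_ac)
qed

text \<open>Jensen's inequality for the concave \<open>2/3\<close>-power, from its tangent at the
  mean.\<close>

lemma sum_powr_two_thirds_le:
  fixes x :: "'a \<Rightarrow> real"
  assumes "finite S" "S \<noteq> {}" "\<And>i. i \<in> S \<Longrightarrow> 0 \<le> x i"
  shows "(\<Sum>i\<in>S. x i powr (2/3)) \<le> real (card S) * ((\<Sum>i\<in>S. x i) / real (card S)) powr (2/3)"
proof -
  define c where "c = (\<Sum>i\<in>S. x i) / real (card S)"
  have n: "real (card S) > 0" using assms by (simp add: card_gt_0_iff)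
  have c: "c \<ge> 0" unfolding c_def using assms by (auto intro!: divide_nonneg_nonneg sum_nonneg)
  show ?thesis
  proof (cases "c = 0")
    case True
    then have "(\<Sum>i\<in>S. x i) = 0" using n by (simp add: c_def)
    then have "\<forall>i\<in>S. x i = 0" using assms by (simp add: sum_nonneg_eq_0_iff)
    then show ?thesis by simp
  next
    case False
    then have c: "c > 0" using c by simp
    have "x i powr (2/3) \<le> c powr (2/3) * (1 + 2/3 * (x i / c - 1))" if "i \<in> S" for i
    proof -
      have "0 \<le> x i / c" using assms(3)[OF that] c by simp
      then have "(x i / c) powr (2/3) \<le> 1 + 2/3 * (x i / c - 1)" by (intro powr_le_tangent) auto
      then have "c powr (2/3) * (x i / c) powr (2/3) \<le> c powr (2/3) * (1 + 2/3 * (x i / c - 1))"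
        by (intro mult_left_mono) auto
      moreover have "c powr (2/3) * (x i / c) powr (2/3) = (c * (x i / c)) powr (2/3)"
        using c \<open>0 \<le> x i / c\<close> by (simp only: powr_mult)
      ultimately show ?thesis using c by simp
    qed
    then have "(\<Sum>i\<in>S. x i powr (2/3)) \<le> (\<Sum>i\<in>S. c powr (2/3) * (1 + 2/3 * (x i / c - 1)))"
      by (rule sum_mono)
    also have "\<dots> = c powr (2/3) * (real (card S) + 2/3 * ((\<Sum>i\<in>S. x i) / c - real (card S)))"
      by (simp add: sum.distrib sum_subtractf flip: sum_distrib_left sum_divide_distrib)
    also have "(\<Sum>i\<in>S. x i) / c = real (card S)" using n c by (auto simp: c_def field_simps)
    finally show ?thesis by (simp add: c_def mult_ac)
  qed
qed

section \<open>Walks and 4-cycles\<close>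

lemma sum_edges_Image:
  fixes f :: "'a \<Rightarrow> 'b \<Rightarrow> 'c::comm_monoid_add"
  assumes "finite A" "finite B" "E \<subseteq> A \<times> B"
  shows "(\<Sum>(u, v)\<in>E. f u v) = (\<Sum>u\<in>A. \<Sum>v\<in>E `` {u}. f u v)"
proof -
  have "E = (SIGMA u:A. E `` {u})" using assms by auto
  moreover have "\<forall>u\<in>A. finite (E `` {u})"
    using assms by (meson finite_Image finite_SigmaI finite_subset)
  ultimately show ?thesis using sum.Sigma[of A "\<lambda>u. E `` {u}" f] assms(1) by auto
qed

text \<open>Walks \<open>u, v, u'\<close> of length two, with \<open>u' = u\<close> allowed;
  equivalently, the edges with an end in the neighbourhood of \<open>u\<close>.\<close>

definition walks2 :: "('a \<times> 'b) set \<Rightarrow> 'a \<Rightarrow> nat" where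
  "walks2 E u = (\<Sum>v\<in>E `` {u}. card (E\<inverse> `` {v}))"

text \<open>If \<open>(u, v)\<close> is an edge, these are the edges opposite to it in a 4-cycle.\<close>

definition between :: "('a \<times> 'b) set \<Rightarrow> 'a \<Rightarrow> 'b \<Rightarrow> ('a \<times> 'b) set" where
  "between E u v = E \<inter> (E\<inverse> `` {v}) \<times> (E `` {u})"

lemma card_between_converse: "card (between (E\<inverse>) v u) = card (between E u v)"
  unfolding between_def by (simp add: card_converse_Int_Times)

lemma card_edges_into_neighbours:
  assumes "finite A" "finite B" "E \<subseteq> A \<times> B"
  shows "card (E \<inter> A \<times> (E `` {u})) = walks2 E u"
proof -
  have "finite (E `` {u})" using assms by (meson finite_Image finite_SigmaI finite_subset)
  then have "card (E \<inter> A \<times> (E `` {u})) = (\<Sum>v\<in>E `` {u}. card ((E \<inter> A \<times> (E `` {u}))\<inverse> `` {v}))"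
    by (intro card_sum_converse_Image[OF assms(1)]) auto
  also have "\<dots> = walks2 E u"
    unfolding walks2_def by (intro sum.cong refl arg_cong[of _ _ card]) (use assms in auto)
  finally show ?thesis .
qed

text \<open>With \<open>c \<alpha>\<close> the codegree of \<open>u\<close> and
  \<open>\<alpha>\<close>, the walks number \<open>\<Sum> c\<close> and the opposite edges, summed
  over the edges at \<open>u\<close>, number \<open>\<Sum> c^2\<close>. Cauchy-Schwarz compares the
  two.\<close>

lemma walks2_squared_le:
  assumes fin: "finite A" "finite B" and sub: "E \<subseteq> A \<times> B"
  shows "(walks2 E u)\<^sup>2 \<le> card A * (\<Sum>v\<in>E `` {u}. card (between E u v))"
proof -
  have finE: "finite E" using assms finite_subset by blast
  define c where "c \<alpha> = card (E `` {u} \<inter> E `` {\<alpha>})" for \<alpha>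
  have finN: "finite (E `` {x})" for x using finE by (simp add: finite_Image)
  have "walks2 E u = card (E \<inter> A \<times> (E `` {u}))" using card_edges_into_neighbours[OF assms] by simp
  also have "\<dots> = (\<Sum>\<alpha>\<in>A. card ((E \<inter> A \<times> (E `` {u})) `` {\<alpha>}))"
    by (rule card_sum_Image[OF fin(1) finN]) auto
  also have "\<dots> = (\<Sum>\<alpha>\<in>A. c \<alpha>)"
    unfolding c_def by (intro sum.cong refl arg_cong[of _ _ card]) auto
  finally have 1: "walks2 E u = (\<Sum>\<alpha>\<in>A. c \<alpha>)" .
  have "(\<Sum>v\<in>E `` {u}. card (between E u v)) = (\<Sum>v\<in>E `` {u}. \<Sum>\<alpha>\<in>A. of_bool ((\<alpha>, v) \<in> E) * c \<alpha>)"
  proof (rule sum.cong[OF refl])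
    fix v assume v: "v \<in> E `` {u}"
    have "card (between E u v) = (\<Sum>\<alpha>\<in>A. card (between E u v `` {\<alpha>}))"
      by (rule card_sum_Image[OF fin]) (use sub in \<open>auto simp: between_def\<close>)
    also have "\<dots> = (\<Sum>\<alpha>\<in>A. of_bool ((\<alpha>, v) \<in> E) * c \<alpha>)"
    proof (rule sum.cong[OF refl])
      fix \<alpha> assume "\<alpha> \<in> A"
      have "between E u v `` {\<alpha>} = (if (\<alpha>, v) \<in> E then E `` {u} \<inter> E `` {\<alpha>} else {})"
        by (auto simp: between_def)
      then show "card (between E u v `` {\<alpha>}) = of_bool ((\<alpha>, v) \<in> E) * c \<alpha>" by (simp add: c_def)
    qed
    finally show "card (between E u v) = (\<Sum>\<alpha>\<in>A. of_bool ((\<alpha>, v) \<in> E) * c \<alpha>)" .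
  qed
  also have "\<dots> = (\<Sum>\<alpha>\<in>A. (\<Sum>v\<in>E `` {u}. of_bool ((\<alpha>, v) \<in> E)) * c \<alpha>)"
    by (subst sum.swap) (simp add: sum_distrib_right)
  also have "\<dots> = (\<Sum>\<alpha>\<in>A. (c \<alpha>)\<^sup>2)"
  proof (rule sum.cong[OF refl])
    fix \<alpha>
    have "E `` {u} \<inter> {v. (\<alpha>, v) \<in> E} = E `` {u} \<inter> E `` {\<alpha>}" by auto
    then have "(\<Sum>v\<in>E `` {u}. of_bool ((\<alpha>, v) \<in> E)) = c \<alpha>" using finN by (simp add: c_def)
    then show "(\<Sum>v\<in>E `` {u}. of_bool ((\<alpha>, v) \<in> E)) * c \<alpha> = (c \<alpha>)\<^sup>2" by (simp add: power2_eq_square)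
  qed
  finally have 2: "(\<Sum>v\<in>E `` {u}. card (between E u v)) = (\<Sum>\<alpha>\<in>A. (c \<alpha>)\<^sup>2)" .
  have "(\<Sum>\<alpha>\<in>A. real (c \<alpha>))\<^sup>2 \<le> real (card A) * (\<Sum>\<alpha>\<in>A. (real (c \<alpha>))\<^sup>2)"
    using sum_squared_le_sum_of_squares[of "\<lambda>\<alpha>. real (c \<alpha>)" A] by (simp add: mult.commute)
  then have "real ((\<Sum>\<alpha>\<in>A. c \<alpha>)\<^sup>2) \<le> real (card A * (\<Sum>\<alpha>\<in>A. (c \<alpha>)\<^sup>2))" by simp
  then show ?thesis unfolding 1 2 by (simp only: of_nat_le_iff)
qed

text \<open>The power mean inequality with weights \<open>d\<close>, when only a lower bound
  \<open>m\<close> on the weighted mean of \<open>w\<close> is known. Bernoulli's inequality at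
  \<open>w i / m\<close> supplies the tangent.\<close>

lemma weighted_power_mean:
  fixes d w :: "'a \<Rightarrow> real"
  assumes nn: "\<And>i. i \<in> S \<Longrightarrow> 0 \<le> d i" "\<And>i. i \<in> S \<Longrightarrow> 0 \<le> w i" "0 \<le> m"
    and mean: "m * (\<Sum>i\<in>S. d i) \<le> (\<Sum>i\<in>S. d i * w i)"
  shows "m ^ r * (\<Sum>i\<in>S. d i) \<le> (\<Sum>i\<in>S. d i * w i ^ r)"
proof (cases "m = 0 \<or> r = 0")
  case True
  then show ?thesis using nn by (cases "r = 0") (auto simp: power_0_left intro!: sum_nonneg)
next
  case False
  then have m: "m > 0" using nn by simp
  have "m ^ r * (1 + real r * (w i / m - 1)) \<le> w i ^ r" if "i \<in> S" for i
  proof -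
    have "1 + real r * (w i / m - 1) \<le> (1 + (w i / m - 1)) ^ r"
      by (rule Bernoulli_inequality) (use nn(2)[OF that] m in simp)
    then have "m ^ r * (1 + real r * (w i / m - 1)) \<le> m ^ r * (w i / m) ^ r"
      using m by (intro mult_left_mono) auto
    then show ?thesis using m by (simp add: power_divide)
  qed
  then have "(\<Sum>i\<in>S. d i * (m ^ r * (1 + real r * (w i / m - 1)))) \<le> (\<Sum>i\<in>S. d i * w i ^ r)"
    by (intro sum_mono mult_left_mono nn) auto
  moreover have "(\<Sum>i\<in>S. d i * (m ^ r * (1 + real r * (w i / m - 1))))
     = m ^ r * ((\<Sum>i\<in>S. d i) + real r * ((\<Sum>i\<in>S. d i * w i) / m - (\<Sum>i\<in>S. d i)))"
    unfolding sum_divide_distrib sum_subtractf[symmetric] sum_distrib_left sum.distrib[symmetric]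
    by (intro sum.cong refl) (simp add: algebra_simps)
  moreover have "(\<Sum>i\<in>S. d i) \<le> (\<Sum>i\<in>S. d i * w i) / m" using mean m by (simp add: field_simps)
  then have "m ^ r * (\<Sum>i\<in>S. d i) \<le>
     m ^ r * ((\<Sum>i\<in>S. d i) + real r * ((\<Sum>i\<in>S. d i * w i) / m - (\<Sum>i\<in>S. d i)))"
    using m by (intro mult_left_mono) auto
  ultimately show ?thesis by linarith
qed

section \<open>Edge density and weighted counts of opposite edges\<close>

definition edge_density :: "('a \<times> 'b) set \<Rightarrow> 'a set \<Rightarrow> 'b set \<Rightarrow> real" where
  "edge_density E A B = real (card E) / (real (card A) * real (card B))"

lemma edge_density_converse: "edge_density (E\<inverse>) B A = edge_density E A B"
  by (simp add: edge_density_def card_inverse mult.commute)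

lemma extremal_min_degree':
  assumes ex: "extremal g E A B" and g: "0 \<le> g" "g \<le> 1"
  shows "u \<in> A \<Longrightarrow> g * edge_density E A B * real (card B) \<le> real (card (E `` {u}))"
    and "v \<in> B \<Longrightarrow> g * edge_density E A B * real (card A) \<le> real (card (E\<inverse> `` {v}))"
  using extremal_min_degree[OF ex g, of u] extremal_min_degree[OF extremal_converse[OF ex] g, of v]
    extremalD(5,6)[OF ex]
  by (simp_all add: edge_density_def card_inverse field_simps)

lemma walks2_ge:
  assumes ex: "extremal g E A B" and g: "0 \<le> g" "g \<le> 1"
  shows "g * edge_density E A B * real (card A) * real (card (E `` {u})) \<le> real (walks2 E u)"
proof -
  have "real (card (E `` {u})) * (g * edge_density E A B * real (card A)) \<le> (\<Sum>v\<in>E `` {u}. real (card (E\<inverse> `` {v})))"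
    using extremalD(3)[OF ex] extremal_min_degree'(2)[OF ex g]
    by (intro sum_bounded_below) auto
  then show ?thesis by (simp add: walks2_def mult_ac)
qed

text \<open>For an edge \<open>(u, v)\<close>: the number of ways to choose \<open>r\<close> edges
  of \<open>between E u v\<close> with repetition, a neighbour of \<open>u\<close> and a neighbour
  of \<open>v\<close>. This counts the configurations through the edge before distinctness is
  imposed.\<close>

definition weighted_walks :: "nat \<Rightarrow> ('a \<times> 'b) set \<Rightarrow> 'a \<Rightarrow> 'b \<Rightarrow> real" where
  "weighted_walks r E u v = real (card (between E u v)) ^ r * real (card (E `` {u})) * real (card (E\<inverse> `` {v}))"

lemma weighted_walks_converse: "weighted_walks r (E\<inverse>) v u = weighted_walks r E u v"
  by (simp add: weighted_walks_def card_between_converse)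

text \<open>Cauchy-Schwarz and the minimum degree of \<open>v\<close> show that, weighted by the
  degrees of \<open>v\<close>, the size of \<open>between E u v\<close> has mean at least
  \<open>g * p * W\<close>, where \<open>p\<close> is the edge density and
  \<open>W = walks2 E u\<close>. The power mean inequality raises this to the power
  \<open>r\<close>.\<close>

lemma sum_weighted_walks_ge:
  assumes ex: "extremal g E A B" and g: "0 \<le> g" "g \<le> 1"
  shows "real (card (E `` {u})) * real (walks2 E u) * (g * edge_density E A B * real (walks2 E u)) ^ r
    \<le> (\<Sum>v\<in>E `` {u}. weighted_walks r E u v)"
proof -
  note D = extremalD[OF ex]
  let ?d = "\<lambda>v. real (card (E\<inverse> `` {v}))" and ?w = "\<lambda>v. real (card (between E u v))"
  let ?p = "edge_density E A B" and ?W = "real (walks2 E u)"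
  have W: "?W = (\<Sum>v\<in>E `` {u}. ?d v)" by (simp add: walks2_def)
  have p0: "?p \<ge> 0" by (simp add: edge_density_def)
  have "?W\<^sup>2 \<le> real (card A) * (\<Sum>v\<in>E `` {u}. ?w v)"
    using walks2_squared_le[OF D(1-3), of u] by (simp flip: of_nat_power of_nat_mult of_nat_sum)
  then have "g * ?p * ?W\<^sup>2 \<le> g * ?p * (real (card A) * (\<Sum>v\<in>E `` {u}. ?w v))"
    using g p0 by (intro mult_left_mono) auto
  also have "\<dots> = (\<Sum>v\<in>E `` {u}. (g * ?p * real (card A)) * ?w v)" by (simp add: sum_distrib_left mult_ac)
  also have "\<dots> \<le> (\<Sum>v\<in>E `` {u}. ?d v * ?w v)"
    using D(3) extremal_min_degree'(2)[OF ex g] by (intro sum_mono mult_right_mono) auto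
  finally have "(g * ?p * ?W) * (\<Sum>v\<in>E `` {u}. ?d v) \<le> (\<Sum>v\<in>E `` {u}. ?d v * ?w v)"
    by (simp add: W[symmetric] power2_eq_square mult_ac)
  then have "(g * ?p * ?W) ^ r * (\<Sum>v\<in>E `` {u}. ?d v) \<le> (\<Sum>v\<in>E `` {u}. ?d v * ?w v ^ r)"
    using g p0 by (intro weighted_power_mean) auto
  then have "real (card (E `` {u})) * ((g * ?p * ?W) ^ r * ?W) \<le> real (card (E `` {u})) * (\<Sum>v\<in>E `` {u}. ?d v * ?w v ^ r)"
    unfolding W[symmetric] by (intro mult_left_mono) auto
  then show ?thesis by (simp add: weighted_walks_def sum_distrib_left mult_ac)
qed

text \<open>Edges with few opposite edges carry little weight. At a vertex \<open>u\<close> of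
  degree \<open>d\<close> they contribute at most \<open>(4 * r^2 * d)^r * d * W\<close>, while the
  total is at least \<open>(g * p * W)^r * d * W\<close>. The bound on \<open>card A\<close> makes
  \<open>g * p * W \<ge> 16 * r^2 * d\<close>, a gain of \<open>4^r \<ge> 4\<close>.\<close>

lemma sum_bad_weighted_walks_le:
  assumes ex: "extremal g E A B" and g: "0 \<le> g" "g \<le> 1" and r: "r \<ge> 1"
    and big: "16 * real r ^ 2 \<le> g ^ 2 * edge_density E A B ^ 2 * real (card A)"
  shows "4 * (\<Sum>(u, v)\<in>{(u, v)\<in>E. card (between E u v) < 4 * r ^ 2 * card (E `` {u})}. weighted_walks r E u v)
    \<le> (\<Sum>(u, v)\<in>E. weighted_walks r E u v)"
proof -
  note D = extremalD[OF ex]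
  let ?p = "edge_density E A B"
  let ?bad = "{(u, v)\<in>E. card (between E u v) < 4 * r ^ 2 * card (E `` {u})}"
  have sub: "?bad \<subseteq> A \<times> B" using D(3) by auto
  have p0: "?p \<ge> 0" by (simp add: edge_density_def)
  have "4 * (\<Sum>v\<in>?bad `` {u}. weighted_walks r E u v) \<le> (\<Sum>v\<in>E `` {u}. weighted_walks r E u v)" for u
  proof -
    let ?du = "real (card (E `` {u}))" and ?W = "real (walks2 E u)"
    have "16 * real r ^ 2 * ?du \<le> (g ^ 2 * ?p ^ 2 * real (card A)) * ?du"
      using big by (intro mult_right_mono) auto
    also have "\<dots> = (g * ?p) * (g * ?p * real (card A) * ?du)" by (simp add: power2_eq_square mult_ac)
    also have "\<dots> \<le> (g * ?p) * ?W" using walks2_ge[OF ex g, of u] g p0 by (intro mult_left_mono) auto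
    finally have le: "16 * real r ^ 2 * ?du \<le> g * ?p * ?W" .
    have "(4::real) \<le> 4 ^ r" using r by (cases r) auto
    then have "4 * (4 * real r ^ 2 * ?du) ^ r \<le> 4 ^ r * (4 * real r ^ 2 * ?du) ^ r"
      by (intro mult_right_mono) auto
    also have "\<dots> = (4 * (4 * real r ^ 2 * ?du)) ^ r" by (rule power_mult_distrib[symmetric])
    also have "\<dots> = (16 * real r ^ 2 * ?du) ^ r" by (rule arg_cong[of _ _ "\<lambda>z. z ^ r"]) simp
    also have "\<dots> \<le> (g * ?p * ?W) ^ r" using le by (intro power_mono) auto
    finally have le2: "4 * (4 * real r ^ 2 * ?du) ^ r \<le> (g * ?p * ?W) ^ r" .
    have "(\<Sum>v\<in>?bad `` {u}. weighted_walks r E u v) \<le> (\<Sum>v\<in>?bad `` {u}. (4 * real r ^ 2 * ?du) ^ r * ?du * real (card (E\<inverse> `` {v})))"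
      unfolding weighted_walks_def
    proof (intro sum_mono mult_right_mono power_mono)
      fix v assume "v \<in> ?bad `` {u}"
      then have "card (between E u v) \<le> 4 * r ^ 2 * card (E `` {u})" by auto
      then have "real (card (between E u v)) \<le> real (4 * r ^ 2 * card (E `` {u}))" by (simp only: of_nat_le_iff)
      then show "real (card (between E u v)) \<le> 4 * real r ^ 2 * ?du" by simp
    qed auto
    also have "\<dots> \<le> (\<Sum>v\<in>E `` {u}. (4 * real r ^ 2 * ?du) ^ r * ?du * real (card (E\<inverse> `` {v})))"
      using D(4) by (intro sum_mono2) (auto intro: finite_Image)
    also have "\<dots> = (4 * real r ^ 2 * ?du) ^ r * ?du * ?W" by (simp add: walks2_def sum_distrib_left)
    finally have "4 * (\<Sum>v\<in>?bad `` {u}. weighted_walks r E u v) \<le> 4 * (4 * real r ^ 2 * ?du) ^ r * (?du * ?W)"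
      by simp
    also have "\<dots> \<le> (g * ?p * ?W) ^ r * (?du * ?W)" using le2 by (intro mult_right_mono) auto
    also have "\<dots> \<le> (\<Sum>v\<in>E `` {u}. weighted_walks r E u v)"
      using sum_weighted_walks_ge[OF ex g, of u r] by (simp add: mult_ac)
    finally show ?thesis .
  qed
  then have "(\<Sum>u\<in>A. 4 * (\<Sum>v\<in>?bad `` {u}. weighted_walks r E u v)) \<le> (\<Sum>u\<in>A. \<Sum>v\<in>E `` {u}. weighted_walks r E u v)"
    by (rule sum_mono)
  then show ?thesis
    unfolding sum_edges_Image[OF D(1,2) sub] sum_edges_Image[OF D(1-3)] by (simp add: sum_distrib_left)
qed

section \<open>Configurations\<close>

text \<open>Greedy choice: each edge already chosen blocks at most \<open>k1 + k2\<close> edges. The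
  separate bound \<open>R\<close> keeps the base of the power fixed during the induction on
  \<open>r\<close>.\<close>

lemma card_disjoint_tuples_ge:
  fixes W :: "('a \<times> 'b) set"
  assumes fin: "finite W" and k: "\<And>a. card {f \<in> W. fst f = a} \<le> k1" "\<And>b. card {f \<in> W. snd f = b} \<le> k2"
    and r: "r \<le> R"
  shows "(card W - R * (k1 + k2)) ^ r \<le> card {F \<in> tuples W r. distinct (map fst F) \<and> distinct (map snd F)}"
  using r
proof (induction r)
  case 0
  have "{F \<in> tuples W 0. distinct (map fst F) \<and> distinct (map snd F)} = {[]}" by auto
  then show ?case by simp
next
  case (Suc r)
  let ?D = "\<lambda>r. {F \<in> tuples W r. distinct (map fst F) \<and> distinct (map snd F)}"
  let ?m = "card W - R * (k1 + k2)"
  define ok where "ok F = W - (\<Union>f'\<in>set F. {f\<in>W. fst f = fst f'} \<union> {f\<in>W. snd f = snd f'})" for F :: "('a \<times> 'b) list"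
  have finD: "finite (?D r)" using finite_tuples[OF fin] by simp
  have ok: "?m \<le> card (ok F)" if "F \<in> ?D r" for F
  proof -
    let ?C = "\<Union>f'\<in>set F. {f\<in>W. fst f = fst f'} \<union> {f\<in>W. snd f = snd f'}"
    have "card ?C \<le> (\<Sum>f'\<in>set F. card ({f\<in>W. fst f = fst f'} \<union> {f\<in>W. snd f = snd f'}))"
      by (rule card_UN_le) simp
    also have "\<dots> \<le> (\<Sum>f'\<in>set F. k1 + k2)"
      by (intro sum_mono order_trans[OF card_Un_le] add_mono k)
    also have "\<dots> \<le> R * (k1 + k2)"
      using that Suc.prems card_length[of F] by (auto simp: tuples_def intro!: mult_le_mono1)
    finally have "card ?C \<le> R * (k1 + k2)" .
    moreover have "card W - card ?C \<le> card (ok F)"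
      unfolding ok_def by (rule diff_card_le_card_Diff) (use fin in auto)
    ultimately show ?thesis by linarith
  qed
  have "?m ^ Suc r = ?m ^ r * ?m" by simp
  also have "\<dots> \<le> card (?D r) * ?m" using Suc by (intro mult_le_mono1) auto
  also have "\<dots> = (\<Sum>F\<in>?D r. ?m)" by simp
  also have "\<dots> \<le> (\<Sum>F\<in>?D r. card (ok F))" using ok by (rule sum_mono)
  also have "\<dots> = card (SIGMA F:?D r. ok F)"
    using finD fin by (simp add: ok_def)
  also have "\<dots> = card ((\<lambda>(F, f). f # F) ` (SIGMA F:?D r. ok F))"
    by (rule card_image[symmetric]) (auto simp: inj_on_def)
  also have "\<dots> \<le> card (?D (Suc r))"
  proof (rule card_mono)
    show "finite (?D (Suc r))" using finite_tuples[OF fin] by simp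
    show "(\<lambda>(F, f). f # F) ` (SIGMA F:?D r. ok F) \<subseteq> ?D (Suc r)"
      by (auto simp: ok_def tuples_def)
  qed
  finally show ?case .
qed

definition common_nbrs :: "('a \<times> 'b) set \<Rightarrow> 'a set \<Rightarrow> 'b list \<Rightarrow> 'a set" where
  "common_nbrs E A S = {u \<in> A. \<forall>s\<in>set S. (u, s) \<in> E}"

text \<open>A configuration \<open>(F, s, t')\<close> consists of edges \<open>(Y'\<^sub>j, X'\<^sub>j)\<close> for \<open>j \<ge> 3\<close> in \<open>F\<close> together with the
  vertices \<open>s = X'\<^sub>2\<close> and \<open>t' = Y'\<^sub>1\<close>.\<close>

definition configs :: "nat \<Rightarrow> ('a \<times> 'b) set \<Rightarrow> 'a set \<Rightarrow> 'b set \<Rightarrow> (('a \<times> 'b) list \<times> 'b \<times> 'a) set" where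
  "configs r E A B = {(F, s, t'). F \<in> tuples E r \<and> s \<in> B \<and> t' \<in> A \<and>
     distinct (s # map snd F) \<and> distinct (t' # map fst F)}"

definition config_edges :: "('a \<times> 'b) set \<Rightarrow> 'a set \<Rightarrow> 'b set \<Rightarrow> ('a \<times> 'b) list \<times> 'b \<times> 'a \<Rightarrow> ('a \<times> 'b) set" where
  "config_edges E A B = (\<lambda>(F, s, t'). E \<inter> common_nbrs E A (s # map snd F) \<times> common_nbrs (E\<inverse>) B (t' # map fst F))"

lemma finite_configs:
  assumes "finite A" "finite B" "finite E" shows "finite (configs r E A B)"
  by (rule finite_subset[of _ "tuples E r \<times> B \<times> A"]) (use assms finite_tuples in \<open>auto simp: configs_def\<close>)

text \<open>First \<open>F\<close> is chosen as \<open>r\<close> vertex-disjoint edges of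
  \<open>between E u v\<close>, then \<open>s\<close> among the neighbours of \<open>u\<close> and
  \<open>t'\<close> among those of \<open>v\<close>, avoiding \<open>F\<close>. On
  \<open>between E u v\<close> a vertex of \<open>A\<close> lies on at most deg(u) edges and a
  vertex of \<open>B\<close> on at most deg(v). Differences that would be negative truncate to
  0.\<close>

lemma card_configs_at_edge_ge:
  assumes fin: "finite A" "finite B" and sub: "E \<subseteq> A \<times> B" and uv: "(u, v) \<in> E"
  shows "(card (between E u v) - r * (card (E `` {u}) + card (E\<inverse> `` {v}))) ^ r
      * (card (E `` {u}) - r) * (card (E\<inverse> `` {v}) - r)
    \<le> card {\<tau> \<in> configs r E A B. (u, v) \<in> config_edges E A B \<tau>}"
proof -
  let ?W = "between E u v"
  let ?D = "{F \<in> tuples ?W r. distinct (map fst F) \<and> distinct (map snd F)}"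
  have finE: "finite E" using fin sub finite_subset by blast
  have finW: "finite ?W" using finE by (simp add: between_def)
  have finN: "finite (E `` {u})" "finite (E\<inverse> `` {v})" using finE by (simp_all add: finite_Image)
  have finD: "finite ?D" using finite_tuples[OF finW] by simp
  define S where "S = (SIGMA F:?D. (E `` {u} - snd ` set F) \<times> (E\<inverse> `` {v} - fst ` set F))"
  have k1: "card {f \<in> ?W. fst f = a} \<le> card (E `` {u})" for a
    by (rule card_inj_on_le[of snd]) (use finN in \<open>auto simp: between_def inj_on_def\<close>)
  have k2: "card {f \<in> ?W. snd f = b} \<le> card (E\<inverse> `` {v})" for b
    by (rule card_inj_on_le[of fst]) (use finN in \<open>auto simp: between_def inj_on_def\<close>)
  have D: "(card ?W - r * (card (E `` {u}) + card (E\<inverse> `` {v}))) ^ r \<le> card ?D"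
    by (rule card_disjoint_tuples_ge[OF finW k1 k2]) simp
  have "(card ?W - r * (card (E `` {u}) + card (E\<inverse> `` {v}))) ^ r * (card (E `` {u}) - r) * (card (E\<inverse> `` {v}) - r)
     \<le> card ?D * ((card (E `` {u}) - r) * (card (E\<inverse> `` {v}) - r))"
    using D by (simp add: mult.assoc mult_le_mono1)
  also have "\<dots> = (\<Sum>F\<in>?D. (card (E `` {u}) - r) * (card (E\<inverse> `` {v}) - r))" by simp
  also have "\<dots> \<le> (\<Sum>F\<in>?D. card ((E `` {u} - snd ` set F) \<times> (E\<inverse> `` {v} - fst ` set F)))"
  proof (rule sum_mono)
    fix F assume "F \<in> ?D"
    then have l: "length F = r" by (simp add: tuples_def)
    have "card (snd ` set F) \<le> r" "card (fst ` set F) \<le> r"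
      using l card_length[of "map snd F"] card_length[of "map fst F"] by auto
    moreover have "card (E `` {u}) - card (snd ` set F) \<le> card (E `` {u} - snd ` set F)"
      "card (E\<inverse> `` {v}) - card (fst ` set F) \<le> card (E\<inverse> `` {v} - fst ` set F)"
      by (auto intro: diff_card_le_card_Diff)
    ultimately show "(card (E `` {u}) - r) * (card (E\<inverse> `` {v}) - r)
        \<le> card ((E `` {u} - snd ` set F) \<times> (E\<inverse> `` {v} - fst ` set F))"
      unfolding card_cartesian_product by (intro mult_le_mono) linarith+
  qed
  also have "\<dots> = card S" unfolding S_def using finD finN by simp
  also have "\<dots> \<le> card {\<tau> \<in> configs r E A B. (u, v) \<in> config_edges E A B \<tau>}"
  proof (rule card_mono)
    show "finite {\<tau> \<in> configs r E A B. (u, v) \<in> config_edges E A B \<tau>}"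
      using finite_configs[OF fin finE] by simp
    show "S \<subseteq> {\<tau> \<in> configs r E A B. (u, v) \<in> config_edges E A B \<tau>}"
    proof
      fix \<tau> assume "\<tau> \<in> S"
      then obtain F s t' where \<tau>: "\<tau> = (F, s, t')" and F: "F \<in> ?D" and s: "(u, s) \<in> E" "s \<notin> snd ` set F"
        and t': "(t', v) \<in> E" "t' \<notin> fst ` set F" by (auto simp: S_def)
      have mem: "f \<in> E \<and> (u, snd f) \<in> E \<and> (fst f, v) \<in> E" if "f \<in> set F" for f
        using F that by (auto simp: tuples_def between_def)
      have "\<tau> \<in> configs r E A B"
        using F s t' mem sub by (auto simp: \<tau> configs_def tuples_def)
      moreover have "(u, v) \<in> config_edges E A B \<tau>"
        using uv s t' mem sub by (auto simp: \<tau> config_edges_def common_nbrs_def)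
      ultimately show "\<tau> \<in> {\<tau> \<in> configs r E A B. (u, v) \<in> config_edges E A B \<tau>}" by simp
    qed
  qed
  finally show ?thesis .
qed

text \<open>Each of the three factors in \<open>card_configs_at_edge_ge\<close> loses at most a
  factor 2: the degrees because they are at least \<open>2 * r\<close>, the power by Bernoulli's
  inequality, because at most a fraction \<open>1 / (2 * r)\<close> of
  \<open>card (between E u v)\<close> is subtracted.\<close>

lemma card_configs_at_good_edge_ge:
  assumes fin: "finite A" "finite B" and sub: "E \<subseteq> A \<times> B" and uv: "(u, v) \<in> E"
    and du: "2 * r \<le> card (E `` {u})" and dv: "2 * r \<le> card (E\<inverse> `` {v})"
    and good: "r = 0 \<or> (4 * r ^ 2 * card (E `` {u}) \<le> card (between E u v) \<and> 4 * r ^ 2 * card (E\<inverse> `` {v}) \<le> card (between E u v))"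
  shows "weighted_walks r E u v \<le> 8 * real (card {\<tau> \<in> configs r E A B. (u, v) \<in> config_edges E A B \<tau>})"
proof -
  define w x y where "w = card (between E u v)" and "x = card (E `` {u})" and "y = card (E\<inverse> `` {v})"
  have "real w ^ r \<le> 2 * real (w - r * (x + y)) ^ r"
  proof (cases "r = 0")
    case False
    then have "4 * r ^ 2 * x \<le> w" "4 * r ^ 2 * y \<le> w" using good by (auto simp: w_def x_def y_def)
    then have le: "2 * r ^ 2 * (x + y) \<le> w" by (simp add: algebra_simps)
    have "r * (x + y) \<le> r ^ 2 * (x + y)" using False by (intro mult_le_mono1) (simp add: power2_eq_square)
    then have "r * (x + y) \<le> w" using le by linarith
    then have sub': "real (w - r * (x + y)) = real w - real r * (real x + real y)"
      by (subst of_nat_diff) auto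
    have "real (2 * r ^ 2 * (x + y)) \<le> real w" using le by (simp only: of_nat_le_iff)
    then have "real r * (real x + real y) \<le> real w / (2 * real r)"
      using False by (simp add: field_simps power2_eq_square)
    then have "real w * (1 + (- (1 / (2 * real r)))) \<le> real (w - r * (x + y))"
      unfolding sub' by (simp add: algebra_simps)
    moreover have h: "0 \<le> 1 + (- (1 / (2 * real r)))" using False by (simp add: field_simps)
    ultimately have "(real w * (1 + (- (1 / (2 * real r))))) ^ r \<le> real (w - r * (x + y)) ^ r"
      by (intro power_mono) auto
    moreover have "1 + real r * (- (1 / (2 * real r))) \<le> (1 + (- (1 / (2 * real r)))) ^ r"
      by (rule Bernoulli_inequality) (use h in linarith)
    then have "1 / 2 \<le> (1 + (- (1 / (2 * real r)))) ^ r" using False by simp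
    then have "real w ^ r * (1 / 2) \<le> real w ^ r * (1 + (- (1 / (2 * real r)))) ^ r"
      by (intro mult_left_mono) auto
    ultimately show ?thesis by (simp add: power_mult_distrib)
  qed simp
  moreover have "real x \<le> 2 * real (x - r)" "real y \<le> 2 * real (y - r)"
    using du dv by (auto simp: x_def y_def of_nat_diff)
  ultimately have "real w ^ r * real x * real y \<le> (2 * real (w - r * (x + y)) ^ r) * (2 * real (x - r)) * (2 * real (y - r))"
    by (intro mult_mono) auto
  also have "\<dots> = 8 * real ((w - r * (x + y)) ^ r * (x - r) * (y - r))" by simp
  also have "\<dots> \<le> 8 * real (card {\<tau> \<in> configs r E A B. (u, v) \<in> config_edges E A B \<tau>})"
    using card_configs_at_edge_ge[OF fin sub uv, of r]
    by (intro mult_left_mono) (simp_all only: w_def x_def y_def of_nat_le_iff zero_le_numeral)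
  finally show ?thesis by (simp add: weighted_walks_def w_def x_def y_def)
qed

text \<open>Double counting of pairs of an edge and a configuration whose
  \<open>config_edges\<close> contain it. The edges bad at \<open>u\<close> and those bad at
  \<open>v\<close> carry at most a quarter of the weight each. Every other edge is counted at least
  an eighth of its weight, hence the constant \<open>16 = 2 * 8\<close>.\<close>

lemma sum_config_edges_ge:
  assumes ex: "extremal g E A B" and g: "0 \<le> g" "g \<le> 1"
    and bigA: "16 * real r ^ 2 \<le> g ^ 2 * edge_density E A B ^ 2 * real (card A)"
    and bigB: "16 * real r ^ 2 \<le> g ^ 2 * edge_density E A B ^ 2 * real (card B)"
    and degA: "2 * real r \<le> g * edge_density E A B * real (card A)"
    and degB: "2 * real r \<le> g * edge_density E A B * real (card B)"
  shows "(\<Sum>(u, v)\<in>E. weighted_walks r E u v) \<le> 16 * (\<Sum>\<tau>\<in>configs r E A B. real (card (config_edges E A B \<tau>)))"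
proof -
  note D = extremalD[OF ex]
  let ?h = "\<lambda>(u, v). weighted_walks r E u v"
  let ?L = "\<Sum>z\<in>E. ?h z"
  \<comment> \<open>The conjunct \<open>r \<noteq> 0\<close> empties both bad sets when there are no
    chosen edges, where \<open>between E u v\<close> does not enter the weight.\<close>
  define b1 where "b1 = {(u, v)\<in>E. r \<noteq> 0 \<and> card (between E u v) < 4 * r ^ 2 * card (E `` {u})}"
  define b2 where "b2 = {(u, v)\<in>E. r \<noteq> 0 \<and> card (between E u v) < 4 * r ^ 2 * card (E\<inverse> `` {v})}"
  have h0: "0 \<le> ?h z" for z by (cases z) (simp add: weighted_walks_def)
  have fb: "finite b1" "finite b2" "b1 \<subseteq> E" "b2 \<subseteq> E" using D(4) by (auto simp: b1_def b2_def intro: finite_subset)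
  have s1: "4 * (\<Sum>z\<in>b1. ?h z) \<le> ?L"
  proof (cases "r = 0")
    case True then show ?thesis using h0 by (simp add: b1_def sum_nonneg)
  next
    case False
    then show ?thesis using sum_bad_weighted_walks_le[OF ex g _ bigA] by (simp add: b1_def)
  qed
  have s2: "4 * (\<Sum>z\<in>b2. ?h z) \<le> ?L"
  proof (cases "r = 0")
    case True then show ?thesis using h0 by (simp add: b2_def sum_nonneg)
  next
    case False
    \<comment> \<open>The second kind of bad edge is the first kind in the converse graph.\<close>
    have "4 * (\<Sum>(v, u)\<in>{(v, u)\<in>E\<inverse>. card (between (E\<inverse>) v u) < 4 * r ^ 2 * card (E\<inverse> `` {v})}. weighted_walks r (E\<inverse>) v u)
        \<le> (\<Sum>(v, u)\<in>E\<inverse>. weighted_walks r (E\<inverse>) v u)"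
      using sum_bad_weighted_walks_le[OF extremal_converse[OF ex] g] False bigB by (simp add: edge_density_converse)
    moreover have "{(v, u)\<in>E\<inverse>. card (between (E\<inverse>) v u) < 4 * r ^ 2 * card (E\<inverse> `` {v})} = prod.swap ` b2"
      using False by (auto simp: b2_def card_between_converse image_iff)
    moreover have "E\<inverse> = prod.swap ` E" by auto
    moreover have "(\<Sum>(v, u)\<in>prod.swap ` Z. weighted_walks r (E\<inverse>) v u) = (\<Sum>z\<in>Z. ?h z)" for Z
      by (subst sum.reindex) (auto simp: weighted_walks_converse case_prod_unfold intro!: sum.cong)
    ultimately show ?thesis by simp
  qed
  let ?c = "\<lambda>z. real (card {\<tau> \<in> configs r E A B. z \<in> config_edges E A B \<tau>})"
  have fc: "finite (configs r E A B)" using finite_configs D by blast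
  have "(\<Sum>z\<in>E - (b1 \<union> b2). ?h z) \<le> (\<Sum>z\<in>E - (b1 \<union> b2). 8 * ?c z)"
  proof (rule sum_mono)
    fix z assume z: "z \<in> E - (b1 \<union> b2)"
    obtain u v where uv: "z = (u, v)" by (cases z)
    have E: "(u, v) \<in> E" "u \<in> A" "v \<in> B" using z uv D(3) by auto
    have "2 * real r \<le> real (card (E `` {u}))" "2 * real r \<le> real (card (E\<inverse> `` {v}))"
      using extremal_min_degree'[OF ex g] E degA degB by force+
    then have "2 * r \<le> card (E `` {u})" "2 * r \<le> card (E\<inverse> `` {v})" by linarith+
    then have "weighted_walks r E u v \<le> 8 * ?c (u, v)"
      by (rule card_configs_at_good_edge_ge[OF D(1-3) E(1)]) (use z uv in \<open>auto simp: b1_def b2_def\<close>)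
    then show "?h z \<le> 8 * ?c z" by (simp add: uv)
  qed
  also have "\<dots> \<le> (\<Sum>z\<in>E. 8 * ?c z)" using D(4) by (intro sum_mono2) auto
  also have "\<dots> = 8 * (\<Sum>z\<in>E. \<Sum>\<tau>\<in>configs r E A B. of_bool (z \<in> config_edges E A B \<tau>))"
    using fc by (simp add: sum_distrib_left Int_def)
  also have "\<dots> = 8 * (\<Sum>\<tau>\<in>configs r E A B. \<Sum>z\<in>E. of_bool (z \<in> config_edges E A B \<tau>))"
    by (subst sum.swap) simp
  also have "\<dots> = 8 * (\<Sum>\<tau>\<in>configs r E A B. real (card (config_edges E A B \<tau>)))"
  proof -
    have "E \<inter> {z. z \<in> config_edges E A B \<tau>} = config_edges E A B \<tau>" for \<tau>
      by (auto simp: config_edges_def)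
    then show ?thesis using D(4) by simp
  qed
  finally have A: "(\<Sum>z\<in>E - (b1 \<union> b2). ?h z) \<le> 8 * (\<Sum>\<tau>\<in>configs r E A B. real (card (config_edges E A B \<tau>)))" .
  have "?L = (\<Sum>z\<in>E - (b1 \<union> b2). ?h z) + (\<Sum>z\<in>b1 \<union> b2. ?h z)"
    using fb D(4) by (intro sum.subset_diff) auto
  also have "(\<Sum>z\<in>b1 \<union> b2. ?h z) \<le> (\<Sum>z\<in>b1. ?h z) + (\<Sum>z\<in>b2. ?h z)"
    using sum.union_inter[OF fb(1,2), of ?h] sum_nonneg[of "b1 \<inter> b2" ?h, OF h0] by linarith
  finally show ?thesis using s1 s2 A by linarith
qed

section \<open>Averages of common neighbourhoods\<close>

lemma finite_common_nbrs: "finite A \<Longrightarrow> finite (common_nbrs E A S)" by (simp add: common_nbrs_def)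

text \<open>Double counting of pairs \<open>(u, S)\<close> where \<open>S\<close> is a
  \<open>k\<close>-tuple of neighbours of \<open>u\<close>.\<close>

lemma sum_card_common_nbrs:
  assumes fin: "finite A" "finite B" and sub: "E \<subseteq> A \<times> B"
  shows "(\<Sum>S\<in>tuples B k. card (common_nbrs E A S)) = (\<Sum>u\<in>A. card (E `` {u}) ^ k)"
proof -
  have "(\<Sum>S\<in>tuples B k. card (common_nbrs E A S)) = (\<Sum>S\<in>tuples B k. \<Sum>u\<in>A. of_bool (\<forall>s\<in>set S. (u, s) \<in> E))"
    using fin by (simp add: common_nbrs_def Int_def)
  also have "\<dots> = (\<Sum>u\<in>A. \<Sum>S\<in>tuples B k. of_bool (\<forall>s\<in>set S. (u, s) \<in> E))" by (rule sum.swap)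
  also have "\<dots> = (\<Sum>u\<in>A. card (E `` {u}) ^ k)"
  proof (rule sum.cong[OF refl])
    fix u assume "u \<in> A"
    have "finite (E `` {u})" using assms by (meson finite_Image finite_SigmaI finite_subset)
    moreover have "tuples B k \<inter> {S. \<forall>s\<in>set S. (u, s) \<in> E} = tuples (E `` {u}) k"
      using sub by (auto simp: tuples_def)
    ultimately show "(\<Sum>S\<in>tuples B k. of_bool (\<forall>s\<in>set S. (u, s) \<in> E)) = card (E `` {u}) ^ k"
      using finite_tuples[OF fin(2), of k] by (simp add: card_tuples)
  qed
  finally show ?thesis .
qed

text \<open>For fixed \<open>u\<close>, the vertex \<open>s\<close> is any neighbour, and each edge
  of \<open>F\<close> is independently one of the \<open>walks2 E u\<close> edges ending in the
  neighbourhood of \<open>u\<close>.\<close>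

lemma sum_card_common_nbrs_edge_tuples:
  assumes fin: "finite A" "finite B" and sub: "E \<subseteq> A \<times> B"
  shows "(\<Sum>F\<in>tuples E r. \<Sum>s\<in>B. card (common_nbrs E A (s # map snd F))) = (\<Sum>u\<in>A. card (E `` {u}) * walks2 E u ^ r)"
proof -
  have finE: "finite E" using fin sub finite_subset by blast
  have "(\<Sum>F\<in>tuples E r. \<Sum>s\<in>B. card (common_nbrs E A (s # map snd F)))
      = (\<Sum>F\<in>tuples E r. \<Sum>s\<in>B. \<Sum>u\<in>A. of_bool ((u, s) \<in> E) * of_bool (\<forall>f\<in>set F. (u, snd f) \<in> E))"
    using fin by (simp add: common_nbrs_def Int_def flip: of_bool_conj)
  also have "\<dots> = (\<Sum>F\<in>tuples E r. \<Sum>u\<in>A. \<Sum>s\<in>B. of_bool ((u, s) \<in> E) * of_bool (\<forall>f\<in>set F. (u, snd f) \<in> E))"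
    by (intro sum.cong refl sum.swap)
  also have "\<dots> = (\<Sum>u\<in>A. \<Sum>F\<in>tuples E r. \<Sum>s\<in>B. of_bool ((u, s) \<in> E) * of_bool (\<forall>f\<in>set F. (u, snd f) \<in> E))"
    by (rule sum.swap)
  also have "\<dots> = (\<Sum>u\<in>A. card (E `` {u}) * walks2 E u ^ r)"
  proof (rule sum.cong[OF refl])
    fix u assume "u \<in> A"
    have "B \<inter> {s. (u, s) \<in> E} = E `` {u}" using sub by auto
    then have 1: "(\<Sum>s\<in>B. of_bool ((u, s) \<in> E)) = card (E `` {u})" using fin by simp
    have "tuples E r \<inter> {F. \<forall>f\<in>set F. (u, snd f) \<in> E} = tuples (E \<inter> A \<times> (E `` {u})) r"
      using sub by (auto simp: tuples_def)
    then have 2: "(\<Sum>F\<in>tuples E r. of_bool (\<forall>f\<in>set F. (u, snd f) \<in> E)) = walks2 E u ^ r"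
      using finite_tuples[OF finE, of r] card_edges_into_neighbours[OF assms, of u] finE
      by (simp add: card_tuples)
    show "(\<Sum>F\<in>tuples E r. \<Sum>s\<in>B. of_bool ((u, s) \<in> E) * of_bool (\<forall>f\<in>set F. (u, snd f) \<in> E))
        = card (E `` {u}) * walks2 E u ^ r"
      unfolding 1[symmetric] 2[symmetric] sum_product by (rule sum.swap)
  qed
  finally show ?thesis .
qed

lemma sum_tuples_converse: "(\<Sum>F\<in>tuples (E\<inverse>) r. f F) = (\<Sum>F\<in>tuples E r. f (map prod.swap F))"
proof -
  have "tuples (E\<inverse>) r = map prod.swap ` tuples E r"
  proof
    show "tuples (E\<inverse>) r \<subseteq> map prod.swap ` tuples E r"
    proof
      fix F assume "F \<in> tuples (E\<inverse>) r"
      then have "map prod.swap F \<in> tuples E r" "F = map prod.swap (map prod.swap F)"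
        by (auto simp: tuples_def o_def)
      then show "F \<in> map prod.swap ` tuples E r" by blast
    qed
  qed (auto simp: tuples_def)
  moreover have "inj_on (map prod.swap) (tuples E r)" by (simp add: inj_on_mapI)
  ultimately show ?thesis by (simp add: sum.reindex o_def)
qed

lemma sum_converse: "(\<Sum>(v, u)\<in>E\<inverse>. f u v) = (\<Sum>(u, v)\<in>E. f u v)"
proof -
  have "E\<inverse> = prod.swap ` E" by auto
  then show ?thesis by (simp add: sum.reindex case_prod_unfold)
qed

text \<open>Serves to absorb the term linear in \<open>|P|\<close> of the theta bound. A vertex
  \<open>u\<close> of degree \<open>d\<close> contributes \<open>card A * d * W^r\<close> to the
  left sum, with \<open>W = walks2 E u\<close>, and at least \<open>d * W * (g * p * W)^r\<close> to
  the right one; the minimum degrees give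
  \<open>W \<ge> (g * p * card A) * (g * p * card B)\<close>.\<close>

lemma sum_card_common_nbrs_le_walks:
  assumes ex: "extremal g E A B" and g: "0 \<le> g" "g \<le> 1"
  shows "(g * edge_density E A B) ^ (r + 2) * real (card B)
      * (\<Sum>F\<in>tuples E r. \<Sum>s\<in>B. \<Sum>t'\<in>A. real (card (common_nbrs E A (s # map snd F))))
    \<le> (\<Sum>(u, v)\<in>E. weighted_walks r E u v)"
proof -
  note D = extremalD[OF ex]
  let ?p = "edge_density E A B" and ?a = "real (card A)" and ?b = "real (card B)"
  let ?d = "\<lambda>u. real (card (E `` {u}))" and ?W = "\<lambda>u. real (walks2 E u)"
  have q: "0 \<le> g * ?p" using g by (simp add: edge_density_def)
  have "(\<Sum>F\<in>tuples E r. \<Sum>s\<in>B. \<Sum>t'\<in>A. real (card (common_nbrs E A (s # map snd F))))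
      = ?a * real (\<Sum>F\<in>tuples E r. \<Sum>s\<in>B. card (common_nbrs E A (s # map snd F)))"
    by (simp add: sum_distrib_left)
  also have "\<dots> = ?a * (\<Sum>u\<in>A. ?d u * ?W u ^ r)" unfolding sum_card_common_nbrs_edge_tuples[OF D(1-3)] by simp
  finally have "(g * ?p) ^ (r + 2) * ?b * (\<Sum>F\<in>tuples E r. \<Sum>s\<in>B. \<Sum>t'\<in>A. real (card (common_nbrs E A (s # map snd F))))
      = (\<Sum>u\<in>A. ?d u * (g * ?p * ?a * (g * ?p * ?b)) * (g * ?p * ?W u) ^ r)"
    by (simp add: sum_distrib_left power_mult_distrib power2_eq_square mult_ac)
  also have "\<dots> \<le> (\<Sum>u\<in>A. ?d u * ?W u * (g * ?p * ?W u) ^ r)"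
  proof (intro sum_mono mult_right_mono mult_left_mono)
    fix u assume "u \<in> A"
    then have "g * ?p * ?a * (g * ?p * ?b) \<le> g * ?p * ?a * ?d u"
      using extremal_min_degree'(1)[OF ex g] q by (intro mult_left_mono) auto
    then show "g * ?p * ?a * (g * ?p * ?b) \<le> ?W u" using walks2_ge[OF ex g, of u] by linarith
  qed (use q in auto)
  also have "\<dots> \<le> (\<Sum>u\<in>A. \<Sum>v\<in>E `` {u}. weighted_walks r E u v)"
    by (intro sum_mono sum_weighted_walks_ge[OF ex g])
  finally show ?thesis unfolding sum_edges_Image[OF D(1-3)] .
qed

lemma sum_card_common_nbrs_le_walks':
  assumes ex: "extremal g E A B" and g: "0 \<le> g" "g \<le> 1"
  shows "(g * edge_density E A B) ^ (r + 2) * real (card A)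
      * (\<Sum>F\<in>tuples E r. \<Sum>s\<in>B. \<Sum>t'\<in>A. real (card (common_nbrs (E\<inverse>) B (t' # map fst F))))
    \<le> (\<Sum>(u, v)\<in>E. weighted_walks r E u v)"
proof -
  have "(\<Sum>F\<in>tuples E r. \<Sum>s\<in>B. \<Sum>t'\<in>A. real (card (common_nbrs (E\<inverse>) B (t' # map fst F))))
     = (\<Sum>F\<in>tuples (E\<inverse>) r. \<Sum>t'\<in>A. \<Sum>s\<in>B. real (card (common_nbrs (E\<inverse>) B (t' # map snd F))))"
    unfolding sum_tuples_converse by (intro sum.cong refl) (simp add: o_def sum_distrib_left)
  moreover have "(\<Sum>(v, u)\<in>E\<inverse>. weighted_walks r (E\<inverse>) v u) = (\<Sum>(u, v)\<in>E. weighted_walks r E u v)"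
    unfolding weighted_walks_converse by (rule sum_converse)
  ultimately show ?thesis
    using sum_card_common_nbrs_le_walks[OF extremal_converse[OF ex] g, of r] by (simp add: edge_density_converse)
qed

text \<open>In the lower bound for a single \<open>u\<close>, the degree and the walk count are
  replaced by what the minimum degrees guarantee. Up to the power of \<open>g\<close> this is the
  value for a graph with all degrees equal to the mean on each side.\<close>

lemma sum_walks_ge:
  assumes ex: "extremal g E A B" and g: "0 \<le> g" "g \<le> 1"
  shows "(g * edge_density E A B) ^ (3 * r + 3) * (real (card A) * real (card B)) ^ (r + 2)
    \<le> (\<Sum>(u, v)\<in>E. weighted_walks r E u v)"
proof -
  note D = extremalD[OF ex]
  let ?p = "edge_density E A B" and ?a = "real (card A)" and ?b = "real (card B)"
  let ?d = "\<lambda>u. real (card (E `` {u}))" and ?W = "\<lambda>u. real (walks2 E u)"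
  have q: "0 \<le> g * ?p" using g by (simp add: edge_density_def)
  have "(g * ?p) ^ (3 * r + 3) * (?a * ?b) ^ (r + 2)
     = ?a * ((g * ?p * ?b) * ((g * ?p * ?a) * (g * ?p * ?b)) * (g * ?p * ((g * ?p * ?a) * (g * ?p * ?b))) ^ r)"
    by (simp add: power_mult_distrib power_add power_mult power2_eq_square power3_eq_cube mult_ac)
  also have "\<dots> = (\<Sum>u\<in>A. (g * ?p * ?b) * ((g * ?p * ?a) * (g * ?p * ?b)) * (g * ?p * ((g * ?p * ?a) * (g * ?p * ?b))) ^ r)"
    by simp
  also have "\<dots> \<le> (\<Sum>u\<in>A. ?d u * ?W u * (g * ?p * ?W u) ^ r)"
  proof (rule sum_mono)
    fix u assume "u \<in> A"
    then have d: "g * ?p * ?b \<le> ?d u" using extremal_min_degree'(1)[OF ex g] by auto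
    then have "g * ?p * ?a * (g * ?p * ?b) \<le> g * ?p * ?a * ?d u" using q by (intro mult_left_mono) auto
    then have W: "g * ?p * ?a * (g * ?p * ?b) \<le> ?W u" using walks2_ge[OF ex g, of u] by linarith
    show "(g * ?p * ?b) * ((g * ?p * ?a) * (g * ?p * ?b)) * (g * ?p * ((g * ?p * ?a) * (g * ?p * ?b))) ^ r
      \<le> ?d u * ?W u * (g * ?p * ?W u) ^ r"
      using q by (intro mult_mono power_mono d W mult_left_mono) (auto intro!: mult_nonneg_nonneg)
  qed
  also have "\<dots> \<le> (\<Sum>u\<in>A. \<Sum>v\<in>E `` {u}. weighted_walks r E u v)"
    by (intro sum_mono sum_weighted_walks_ge[OF ex g])
  finally show ?thesis unfolding sum_edges_Image[OF D(1-3)] .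
qed

lemma sum_card_common_nbrs_moment_le:
  assumes ex: "extremal g E A B" and g: "1 - 1 / real (Suc k) \<le> g"
  shows "(\<Sum>S\<in>tuples B k. real (card (common_nbrs E A S))) / real (card B) ^ k \<le> 2 ^ (k + 2) * real (card A) * edge_density E A B ^ k"
proof -
  note D = extremalD[OF ex]
  have "(\<Sum>S\<in>tuples B k. real (card (common_nbrs E A S))) = (\<Sum>u\<in>A. real (card (E `` {u})) ^ k)"
    using sum_card_common_nbrs[OF D(1-3), of k] by (simp flip: of_nat_sum of_nat_power)
  also have "\<dots> \<le> 2 ^ (k + 2) * real (card A) * (real (card E) / real (card A)) ^ k"
    by (rule sum_degree_power_le[OF ex g])
  finally have "(\<Sum>S\<in>tuples B k. real (card (common_nbrs E A S))) / real (card B) ^ k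
     \<le> 2 ^ (k + 2) * real (card A) * (real (card E) / real (card A)) ^ k / real (card B) ^ k"
    by (intro divide_right_mono) auto
  then show ?thesis by (simp add: edge_density_def power_divide power_mult_distrib)
qed

text \<open>For fixed \<open>s\<close> and \<open>t'\<close> the inequality for tuples of edges
  decouples the two common neighbourhoods. Concavity of the \<open>2/3\<close>-power then averages
  over \<open>s\<close> and \<open>t'\<close>, and the resulting means over
  \<open>(r + 1)\<close>-tuples are degree moments of order \<open>r + 1\<close> on the two
  sides.\<close>

lemma sum_config_powr_le:
  assumes ex: "extremal g E A B" and g: "r = 0 \<or> 5/7 \<le> g" "g \<le> 1" "1 - 1 / real (r + 2) \<le> g"
  defines "m \<equiv> real (card A) * real (card B)" and "p \<equiv> edge_density E A B"
  shows "(\<Sum>F\<in>tuples E r. \<Sum>s\<in>B. \<Sum>t'\<in>A.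
      (real (card (common_nbrs E A (s # map snd F))) * real (card (common_nbrs (E\<inverse>) B (t' # map fst F)))) powr (2/3))
    \<le> (2809 * (m * p)) ^ r * (m * ((2 ^ (r + 3)) ^ 2 * m * p ^ (2 * r + 2)) powr (2/3))"
proof -
  note D = extremalD[OF ex]
  let ?a = "real (card A)" and ?b = "real (card B)"
  define P Q where "P s S = real (card (common_nbrs E A (s # S)))" and "Q t' T = real (card (common_nbrs (E\<inverse>) B (t' # T)))" for s t' S T
  define P' Q' where "P' s = (\<Sum>S\<in>tuples B r. P s S) / ?b ^ r" and "Q' t' = (\<Sum>T\<in>tuples A r. Q t' T) / ?a ^ r" for s t'
  have nn: "0 \<le> P s S" "0 \<le> Q t' T" "0 \<le> P' s" "0 \<le> Q' t'" for s t' S T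
    by (auto simp: P_def Q_def P'_def Q'_def intro!: divide_nonneg_nonneg sum_nonneg)
  have e: "real (card E) = m * p" using D(5,6) by (simp add: m_def p_def edge_density_def card_gt_0_iff)
  have mp: "0 \<le> m" "0 \<le> p" by (auto simp: m_def p_def edge_density_def)
  let ?N = "(2809 * (m * p)) ^ r"
  have "(\<Sum>F\<in>tuples E r. \<Sum>s\<in>B. \<Sum>t'\<in>A. (P s (map snd F) * Q t' (map fst F)) powr (2/3))
      = (\<Sum>s\<in>B. \<Sum>t'\<in>A. \<Sum>F\<in>tuples E r. (Q t' (map fst F) * P s (map snd F)) powr (2/3))"
    by (subst sum.swap, intro sum.cong refl, subst sum.swap) (simp add: mult.commute)
  also have "\<dots> \<le> (\<Sum>s\<in>B. \<Sum>t'\<in>A. ?N * (Q' t' * P' s) powr (2/3))"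
    unfolding P'_def Q'_def e[symmetric]
    by (intro sum_mono sum_edge_tuples_powr_le[OF ex g(1,2)] nn)
  also have "\<dots> = ?N * ((\<Sum>s\<in>B. P' s powr (2/3)) * (\<Sum>t'\<in>A. Q' t' powr (2/3)))"
    unfolding sum_product unfolding sum_distrib_left
    by (intro sum.cong refl) (simp only: powr_mult mult_ac)
  also have "\<dots> \<le> ?N * ((?b * ((\<Sum>s\<in>B. P' s) / ?b) powr (2/3)) * (?a * ((\<Sum>t'\<in>A. Q' t') / ?a) powr (2/3)))"
    using D(1,2,5,6) nn mp by (intro mult_left_mono mult_mono sum_powr_two_thirds_le) (auto intro!: sum_nonneg)
  also have "(\<Sum>s\<in>B. P' s) / ?b = (\<Sum>S\<in>tuples B (r + 1). real (card (common_nbrs E A S))) / ?b ^ (r + 1)"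
    by (simp add: P'_def P_def sum_tuples_Suc flip: sum_divide_distrib)
  also have "(\<Sum>t'\<in>A. Q' t') / ?a = (\<Sum>T\<in>tuples A (r + 1). real (card (common_nbrs (E\<inverse>) B T))) / ?a ^ (r + 1)"
    by (simp add: Q'_def Q_def sum_tuples_Suc flip: sum_divide_distrib)
  also have "?N * ((?b * ((\<Sum>S\<in>tuples B (r + 1). real (card (common_nbrs E A S))) / ?b ^ (r + 1)) powr (2/3)) *
        (?a * ((\<Sum>T\<in>tuples A (r + 1). real (card (common_nbrs (E\<inverse>) B T))) / ?a ^ (r + 1)) powr (2/3)))
     \<le> ?N * ((?b * (2 ^ (r + 3) * ?a * p ^ (r + 1)) powr (2/3)) * (?a * (2 ^ (r + 3) * ?b * p ^ (r + 1)) powr (2/3)))"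
  proof -
    have 1: "(\<Sum>S\<in>tuples B (r + 1). real (card (common_nbrs E A S))) / ?b ^ (r + 1) \<le> 2 ^ (r + 3) * ?a * p ^ (r + 1)"
      using sum_card_common_nbrs_moment_le[OF ex, of "r + 1"] g(3) by (simp add: p_def power_add)
    have 2: "(\<Sum>T\<in>tuples A (r + 1). real (card (common_nbrs (E\<inverse>) B T))) / ?a ^ (r + 1) \<le> 2 ^ (r + 3) * ?b * p ^ (r + 1)"
      using sum_card_common_nbrs_moment_le[OF extremal_converse[OF ex], of "r + 1"] g(3)
      by (simp add: p_def edge_density_converse power_add)
    show ?thesis
      using mp by (intro mult_left_mono mult_mono powr_mono2 1 2) (auto intro!: divide_nonneg_nonneg sum_nonneg)
  qed
  also have "(?b * (2 ^ (r + 3) * ?a * p ^ (r + 1)) powr (2/3)) * (?a * (2 ^ (r + 3) * ?b * p ^ (r + 1)) powr (2/3))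
     = m * ((2 ^ (r + 3) * ?a * p ^ (r + 1)) * (2 ^ (r + 3) * ?b * p ^ (r + 1))) powr (2/3)"
    using mp by (subst powr_mult) (auto simp: m_def)
  also have "(2 ^ (r + 3) * ?a * p ^ (r + 1)) * (2 ^ (r + 3) * ?b * p ^ (r + 1)) = (2 ^ (r + 3)) ^ 2 * m * p ^ (2 * r + 2)"
  proof -
    have "p ^ (2 * r + 2) = p ^ (r + 1) * p ^ (r + 1)" by (subst power_add[symmetric]) (simp add: mult_2)
    then show ?thesis by (simp only: m_def power2_eq_square mult_ac)
  qed
  finally show ?thesis by (simp add: P_def Q_def)
qed

text \<open>\<open>es\<close> lists the edges \<open>(X\<^sub>i, Y\<^sub>i)\<close> and \<open>fs\<close> the edges \<open>(Y'\<^sub>j, X'\<^sub>j)\<close>.\<close>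

definition has_H :: "nat \<Rightarrow> ('a \<times> 'b) set \<Rightarrow> bool" where
  "has_H t E \<longleftrightarrow> (\<exists>es fs. length es = t \<and> length fs = t \<and> set es \<subseteq> E \<and> set fs \<subseteq> E \<and>
     distinct (map fst es @ map fst fs) \<and> distinct (map snd es @ map snd fs) \<and>
     (\<forall>e\<in>set es. \<forall>f\<in>set fs. (fst e, snd f) \<in> E \<and> (fst f, snd e) \<in> E))"

text \<open>A theta graph between \<open>P\<close> and \<open>Q\<close> that avoids the chosen
  vertices completes to a copy of \<open>H\<close>: its middle edges become the
  \<open>(X_i, Y_i)\<close>, and its end vertices \<open>x0\<close> and \<open>y0\<close> are the
  missing partners of \<open>s\<close> and \<open>t'\<close>. So the theta bound applies to
  \<open>E'\<close>. The edges at removed vertices number at most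
  \<open>(r + 1) * (|P| + |Q|)\<close>, which turns 16 into 17.\<close>

lemma card_config_edges_le:
  assumes fin: "finite A" "finite B" and sub: "E \<subseteq> A \<times> B" and nH: "\<not> has_H (r + 2) E"
    and \<tau>: "(F, s, t') \<in> configs r E A B"
  defines "t \<equiv> real (r + 2)" and "P \<equiv> common_nbrs E A (s # map snd F)" and "Q \<equiv> common_nbrs (E\<inverse>) B (t' # map fst F)"
  shows "real (card (config_edges E A B (F, s, t'))) \<le>
    8 * t * (real (card P) * real (card Q)) powr (2/3) + 17 * t ^ 2 * (real (card P) + real (card Q))"
proof -
  have fPQ: "finite P" "finite Q" using fin by (auto simp: P_def Q_def finite_common_nbrs)
  define T S where "T = set (t' # map fst F)" and "S = set (s # map snd F)"
  define E' where "E' = E \<inter> (P - T) \<times> (Q - S)"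
  have F: "length F = r" "set F \<subseteq> E" "distinct (s # map snd F)" "distinct (t' # map fst F)"
    using \<tau> by (auto simp: configs_def tuples_def)
  have "\<not> theta (r + 2) E'"
  proof
    assume "theta (r + 2) E'"
    then obtain x0 y0 zs where z: "length zs = r + 2" "set zs \<subseteq> E'" "distinct (x0 # map fst zs)"
      "distinct (y0 # map snd zs)" "\<forall>z\<in>set zs. (fst z, y0) \<in> E' \<and> (x0, snd z) \<in> E'"
      unfolding theta_def by blast
    then obtain z0 where "z0 \<in> set zs" by (cases zs) auto
    then have y0: "y0 \<in> Q" "y0 \<notin> S" and x0: "x0 \<in> P" "x0 \<notin> T" using z(5) by (auto simp: E'_def)
    have zs: "fst z \<in> P" "fst z \<notin> T" "snd z \<in> Q" "snd z \<notin> S" if "z \<in> set zs" for z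
      using that z(2) by (auto simp: E'_def)
    let ?fs = "(t', y0) # (x0, s) # F"
    have "set zs \<subseteq> E" using z(2) by (auto simp: E'_def)
    moreover have "set ?fs \<subseteq> E" using F(2) x0 y0 by (auto simp: P_def Q_def common_nbrs_def)
    moreover have "distinct (map fst zs @ map fst ?fs)"
    proof -
      have "fst ` set zs \<inter> T = {}" using zs(2) by auto
      then show ?thesis using z(3) F(4) x0(2) by (auto simp: T_def)
    qed
    moreover have "distinct (map snd zs @ map snd ?fs)"
    proof -
      have "snd ` set zs \<inter> S = {}" using zs(4) by auto
      then show ?thesis using z(4) F(3) y0(2) by (auto simp: S_def)
    qed
    moreover have "\<forall>e\<in>set zs. \<forall>f\<in>set ?fs. (fst e, snd f) \<in> E \<and> (fst f, snd e) \<in> E"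
      using zs z(5) by (auto simp: P_def Q_def common_nbrs_def E'_def)
    ultimately have "has_H (r + 2) E"
      unfolding has_H_def using z(1) F(1) by (intro exI[of _ zs] exI[of _ ?fs]) auto
    then show False using nH by simp
  qed
  then have "real (card E') \<le> 8 * t * (real (card P) * real (card Q)) powr (2/3)
           + 16 * t ^ 2 * (real (card P) + real (card Q))"
    unfolding t_def by (rule theta_free_card_le) (use fPQ in \<open>auto simp: E'_def\<close>)
  moreover have "card (config_edges E A B (F, s, t')) \<le> card E' + (r + 1) * card Q + card P * (r + 1)"
  proof -
    have c: "card T \<le> r + 1" "card S \<le> r + 1"
      unfolding T_def S_def using card_length[of "t' # map fst F"] card_length[of "s # map snd F"] F(1) by auto
    have "config_edges E A B (F, s, t') \<subseteq> E' \<union> T \<times> Q \<union> P \<times> S"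
      by (auto simp: config_edges_def E'_def P_def Q_def)
    then have "card (config_edges E A B (F, s, t')) \<le> card (E' \<union> T \<times> Q \<union> P \<times> S)"
      by (rule card_mono[rotated]) (use fPQ in \<open>auto simp: E'_def T_def S_def\<close>)
    also have "\<dots> \<le> card E' + card (T \<times> Q) + card (P \<times> S)"
      by (intro order_trans[OF card_Un_le] add_mono order_refl)
    also have "\<dots> \<le> card E' + (r + 1) * card Q + card P * (r + 1)"
      unfolding card_cartesian_product using c by (intro add_mono mult_le_mono) auto
    finally show ?thesis .
  qed
  then have "real (card (config_edges E A B (F, s, t'))) \<le> real (card E' + (r + 1) * card Q + card P * (r + 1))"
    by (simp only: of_nat_le_iff)
  moreover have "(real r + 1) * (real (card P) + real (card Q)) \<le> t ^ 2 * (real (card P) + real (card Q))"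
    by (intro mult_right_mono) (auto simp: t_def power2_eq_square algebra_simps)
  ultimately show ?thesis by (simp add: algebra_simps)
qed

section \<open>The density threshold\<close>

text \<open>With \<open>k = t - 2\<close> and the roundings \<open>3^9 \<le> 2^15\<close> and
  \<open>2809^3 \<le> 2^35\<close>, it suffices that
  \<open>2^(9 * k) < 2^24 * t^(2 * (k + 1))\<close>. For this any \<open>c\<close> with
  \<open>2^c \<le> t^2\<close> and \<open>9 * k < c * (k + 1) + 24\<close> will do. It is chosen
  range by range in \<open>t\<close>; \<open>c = 10\<close> serves all
  \<open>t \<ge> 32\<close>.\<close>

lemma numeric_bound:
  fixes t :: nat
  assumes "2 \<le> t"
  shows "3 ^ 9 * (256 * t) ^ 3 * 2809 ^ (3 * (t - 2)) * 2 ^ (4 * t + 4) < (2 ^ 15 * t) ^ (2 * t + 1)"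
proof -
  obtain k where k: "t = k + 2" using assms nat_le_iff_add[of 2 t] by auto
  have "\<exists>c. 2 ^ c \<le> t ^ 2 \<and> 9 * k < c * (k + 1) + 24"
  proof -
    consider "t < 4" | "4 \<le> t" "t < 8" | "8 \<le> t" "t < 12" | "12 \<le> t" "t < 16" | "16 \<le> t" "t < 32" | "32 \<le> t"
      by linarith
    then show ?thesis
    proof cases
      case 1 then show ?thesis using power_mono[OF assms, of 2] k by (intro exI[of _ 2]) simp
    next
      case 2 then show ?thesis using power_mono[of 4 t 2] k by (intro exI[of _ 4]) simp
    next
      case 3 then show ?thesis using power_mono[of 8 t 2] k by (intro exI[of _ 6]) simp
    next
      case 4 then show ?thesis using power_mono[of 12 t 2] k by (intro exI[of _ 7]) simp
    next
      case 5 then show ?thesis using power_mono[of 16 t 2] k by (intro exI[of _ 8]) simp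
    next
      case 6 then show ?thesis using power_mono[of 32 t 2] k by (intro exI[of _ 10]) simp
    qed
  qed
  then obtain c where c: "2 ^ c \<le> t ^ 2" "9 * k < c * (k + 1) + 24" by blast
  have "(2809::nat) ^ (3 * k) = (2809 ^ 3) ^ k" by (rule power_mult)
  also have "\<dots> \<le> (2 ^ 35) ^ k" by (rule power_mono) simp_all
  also have "\<dots> = 2 ^ (35 * k)" by (rule power_mult[symmetric])
  finally have 1: "(2809::nat) ^ (3 * k) \<le> 2 ^ (35 * k)" .
  have "(2::nat) ^ (c * (k + 1)) = (2 ^ c) ^ (k + 1)" by (rule power_mult)
  also have "\<dots> \<le> (t ^ 2) ^ (k + 1)" by (rule power_mono[OF c(1)]) simp
  also have "\<dots> = t ^ (2 * (k + 1))" by (rule power_mult[symmetric])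
  finally have 2: "(2::nat) ^ (c * (k + 1)) \<le> t ^ (2 * (k + 1))" .
  have "(256 * t) ^ 3 = 2 ^ 24 * t ^ 3" by (simp add: power_mult_distrib)
  moreover have "4 * t + 4 = 4 * k + 12" "t - 2 = k" by (simp_all add: k)
  ultimately have "3 ^ 9 * (256 * t) ^ 3 * 2809 ^ (3 * (t - 2)) * 2 ^ (4 * t + 4)
      = (3 ^ 9 * (2 ^ 24 * t ^ 3)) * 2809 ^ (3 * k) * 2 ^ (4 * k + 12)"
    by (simp only: mult.assoc)
  also have "\<dots> \<le> (2 ^ 15 * (2 ^ 24 * t ^ 3)) * 2 ^ (35 * k) * 2 ^ (4 * k + 12)"
    by (intro mult_mono 1) simp_all
  also have "\<dots> = 2 ^ (15 + 24 + 35 * k + (4 * k + 12)) * t ^ 3"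
    unfolding power_add by (simp only: mult_ac)
  also have "\<dots> < 2 ^ (15 * (2 * t + 1) + c * (k + 1)) * t ^ 3"
    using c(2) k by (intro mult_strict_right_mono power_strict_increasing) auto
  also have "\<dots> = (2 ^ 15) ^ (2 * t + 1) * (2 ^ (c * (k + 1)) * t ^ 3)"
    unfolding power_add power_mult by (simp only: mult.assoc)
  also have "\<dots> \<le> (2 ^ 15) ^ (2 * t + 1) * (t ^ (2 * (k + 1)) * t ^ 3)"
    by (intro mult_left_mono mult_right_mono 2) auto
  also have "t ^ (2 * (k + 1)) * t ^ 3 = t ^ (2 * t + 1)"
    unfolding power_add[symmetric] by (rule arg_cong[of _ _ "\<lambda>n. t ^ n"]) (simp add: k)
  finally show ?thesis by (simp only: power_mult_distrib)
qed

text \<open>The exponent \<open>g\<close> increases with \<open>t\<close>; \<open>3/5\<close> and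
  \<open>5/7\<close> are its values at \<open>t = 2\<close> and \<open>t = 3\<close>.\<close>

lemma extremal_exponent_bounds:
  fixes t :: nat
  assumes t: "2 \<le> t" and g: "g = (2 * real t - 1) / (2 * real t + 1)"
  shows "0 \<le> g" "g \<le> 1" "3/5 \<le> g" "1 - 1 / real t \<le> g" "t = 2 \<or> 5/7 \<le> g" "1/3 \<le> g ^ (t - 1)"
proof -
  have t2: "real t \<ge> 2" using t by simp
  show "0 \<le> g" "g \<le> 1" "3/5 \<le> g" using t2 by (auto simp: g field_simps)
  show "1 - 1 / real t \<le> g" using t2 by (simp add: g field_simps)
  show "t = 2 \<or> 5/7 \<le> g"
  proof (cases "t = 2")
    case False
    then have "real t \<ge> 3" using t by simp
    then show ?thesis by (auto simp: g field_simps)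
  qed simp
  \<comment> \<open>\<open>1 / g = 1 + x \<le> exp x\<close> and \<open>(t - 1) * x \<le> 1\<close>,
    so \<open>(1 / g) ^ (t - 1) \<le> exp 1 \<le> 3\<close>.\<close>
  define x where "x = 2 / (2 * real t - 1)"
  have "1 / g = 1 + x" using t2 by (simp add: g x_def field_simps)
  then have "(1 / g) ^ (t - 1) \<le> exp x ^ (t - 1)" using t2 by (intro power_mono) (auto simp: x_def)
  also have "\<dots> = exp (real (t - 1) * x)" by (rule exp_of_nat_mult[symmetric])
  also have "\<dots> \<le> exp 1" using t t2 by (simp add: x_def of_nat_diff field_simps)
  also have "\<dots> \<le> 3" by (rule exp_le)
  finally show "1/3 \<le> g ^ (t - 1)" using \<open>3/5 \<le> g\<close> by (simp add: power_divide field_simps)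
qed

text \<open>Without a copy, the theta bound summed over all configurations bounds the weighted count
  \<open>\<Lambda>\<close> by a main term and terms linear in \<open>|P|\<close> and
  \<open>|Q|\<close>. The conditions on the two sides make the linear terms at most half of
  \<open>\<Lambda>\<close>. The main term against the lower bound for \<open>\<Lambda>\<close> then
  contradicts the condition on \<open>m * p ^ (2 * t + 1)\<close>.\<close>

lemma has_H_of_extremal:
  fixes t :: nat
  assumes t: "2 \<le> t" and g: "g = (2 * real t - 1) / (2 * real t + 1)" and ex: "extremal g E A B"
  defines "m \<equiv> real (card A) * real (card B)" and "p \<equiv> edge_density E A B" and "C \<equiv> 2 ^ 15 * real t"
  assumes denseA: "C ^ t \<le> real (card A) * p ^ t" and denseB: "C ^ t \<le> real (card B) * p ^ t"
    and dense: "C ^ (2 * t + 1) \<le> m * p ^ (2 * t + 1)"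
  shows "has_H t E"
proof (rule ccontr)
  assume nH: "\<not> has_H t E"
  note D = extremalD[OF ex]
  note G = extremal_exponent_bounds[OF t g]
  let ?a = "real (card A)" and ?b = "real (card B)"
  obtain r where r: "t = r + 2" using t nat_le_iff_add[of 2 t] by auto
  have t2: "real t \<ge> 2" using t by simp
  have C2: "2 ^ 30 * real t ^ 2 \<le> C ^ t"
  proof -
    have "1 \<le> C" using t2 by (simp add: C_def)
    then have "C ^ 2 \<le> C ^ t" using t by (intro power_increasing) auto
    then show ?thesis by (simp add: C_def power_mult_distrib)
  qed
  have p: "0 < p" "p \<le> 1"
  proof -
    show "0 < p" using D by (auto simp: p_def edge_density_def)
    have "card E \<le> card (A \<times> B)" using D by (intro card_mono) auto
    then have "real (card E) \<le> ?a * ?b" by (simp add: card_cartesian_product flip: of_nat_mult)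
    then show "p \<le> 1" using D by (simp add: p_def edge_density_def divide_le_eq)
  qed
  have m: "0 < m" using D by (simp add: m_def)
  have pt: "p ^ t \<le> p" "p ^ t \<le> p ^ 2"
    using p t power_decreasing[of 1 t p] power_decreasing[of 2 t p] by auto
  \<comment> \<open>As \<open>p \<le> 1\<close> and \<open>t \<ge> 2\<close>, a bound on
    \<open>x * p^t\<close> also bounds \<open>p * x\<close> and \<open>p^2 * x\<close>;
    \<open>x\<close> will be the size of either side.\<close>
  have big: "2 ^ 30 * real t ^ 2 \<le> p * x" "2 ^ 30 * real t ^ 2 \<le> p ^ 2 * x" if "C ^ t \<le> x * p ^ t" "0 \<le> x" for x
    using mult_left_mono[OF pt(1) that(2)] mult_left_mono[OF pt(2) that(2)] that(1) C2
    by (simp_all add: mult.commute)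
  have tt: "real t \<le> real t ^ 2" using t2 by (simp add: power2_eq_square)
  have rt: "real r \<le> real t" by (simp add: r)
  have deg1: "2 * real r \<le> g * p * x" if "C ^ t \<le> x * p ^ t" "0 \<le> x" for x
  proof -
    have "2 * real r \<le> 2 * real t ^ 2" using tt rt by linarith
    also have "\<dots> \<le> 3/5 * (2 ^ 30 * real t ^ 2)" by simp
    also have "\<dots> \<le> g * (p * x)" using big(1)[OF that] G(1,3) by (intro mult_mono[OF G(3)]) auto
    finally show ?thesis by (simp add: mult.assoc)
  qed
  have deg2: "16 * real r ^ 2 \<le> g ^ 2 * p ^ 2 * x" if "C ^ t \<le> x * p ^ t" "0 \<le> x" for x
  proof -
    have "real r ^ 2 \<le> real t ^ 2" using rt by (intro power_mono) auto
    then have "16 * real r ^ 2 \<le> 16 * real t ^ 2" by simp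
    also have "\<dots> \<le> (3/5) ^ 2 * (2 ^ 30 * real t ^ 2)" by (simp add: power_divide)
    also have "\<dots> \<le> g ^ 2 * (p ^ 2 * x)" 
      using mult_mono[OF power_mono[OF G(3), of 2] big(2)[OF that]] by simp
    finally show ?thesis by (simp add: mult.assoc)
  qed
  define \<Lambda> where "\<Lambda> = (\<Sum>(u, v)\<in>E. weighted_walks r E u v)"
  define P Q where "P F s = real (card (common_nbrs E A (s # map snd F)))" and "Q F t' = real (card (common_nbrs (E\<inverse>) B (t' # map fst F)))" for F s t'
  define main SP SQ where "main = (\<Sum>F\<in>tuples E r. \<Sum>s\<in>B. \<Sum>t'\<in>A. (P F s * Q F t') powr (2/3))"
    and "SP = (\<Sum>F\<in>tuples E r. \<Sum>s\<in>B. \<Sum>t'\<in>A. P F s)" and "SQ = (\<Sum>F\<in>tuples E r. \<Sum>s\<in>B. \<Sum>t'\<in>A. Q F t')"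
  let ?f = "\<lambda>F s t'. 8 * real t * (P F s * Q F t') powr (2/3) + 17 * real t ^ 2 * (P F s + Q F t')"
  have nnf: "0 \<le> ?f F s t'" for F s t' by (simp add: P_def Q_def)
  have "(\<Sum>\<tau>\<in>configs r E A B. real (card (config_edges E A B \<tau>))) \<le> (\<Sum>(F, s, t')\<in>configs r E A B. ?f F s t')"
  proof (intro sum_mono)
    fix \<tau> assume \<tau>: "\<tau> \<in> configs r E A B"
    obtain F s t' where eq: "\<tau> = (F, s, t')" by (cases \<tau>)
    show "real (card (config_edges E A B \<tau>)) \<le> (case \<tau> of (F, s, t') \<Rightarrow> ?f F s t')"
      using card_config_edges_le[OF D(1-3), of r F s t'] nH \<tau> by (simp add: eq P_def Q_def r)
  qed
  \<comment> \<open>Dropping the distinctness conditions only adds nonnegative terms and makes the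
    index set a product.\<close>
  also have "\<dots> \<le> (\<Sum>(F, s, t')\<in>tuples E r \<times> B \<times> A. ?f F s t')"
    using D nnf by (intro sum_mono2) (auto simp: configs_def finite_tuples)
  also have "\<dots> = (\<Sum>F\<in>tuples E r. \<Sum>s\<in>B. \<Sum>t'\<in>A. ?f F s t')"
    by (simp add: sum.cartesian_product)
  also have "\<dots> = 8 * real t * main + 17 * real t ^ 2 * (SP + SQ)"
    by (simp add: main_def SP_def SQ_def sum.distrib distrib_left flip: sum_distrib_left)
  finally have "\<Lambda> \<le> 16 * (8 * real t * main + 17 * real t ^ 2 * (SP + SQ))"
    using sum_config_edges_ge[OF ex G(1,2), of r] deg1[OF denseA] deg2[OF denseA] deg1[OF denseB] deg2[OF denseB]
    by (simp add: \<Lambda>_def p_def)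
  then have upper: "\<Lambda> \<le> 128 * real t * main + (272 * real t ^ 2 * SP + 272 * real t ^ 2 * SQ)"
    by (simp add: algebra_simps)
  have g5: "1/5 \<le> g ^ t"
  proof -
    have "1/3 * (3/5) \<le> g ^ (t - 1) * g" using G(3,6) by (intro mult_mono) auto
    then show ?thesis using t by (cases t) (auto simp: mult.commute)
  qed
  \<comment> \<open>\<open>g^t \<ge> 1/5\<close> and \<open>C^t \<ge> 2^30 * t^2\<close> outweigh
    the factor \<open>4 * 272 * t^2\<close>, so each of the two linear terms costs at most a quarter
    of \<open>\<Lambda>\<close>.\<close>
  have linear: "272 * real t ^ 2 * y \<le> \<Lambda> / 4"
    if "(g * p) ^ (r + 2) * x * y \<le> \<Lambda>" "C ^ t \<le> x * p ^ t" "0 \<le> x" "0 \<le> y" for x y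
  proof -
    have "4 * (272 * real t ^ 2) \<le> 1/5 * (2 ^ 30 * real t ^ 2)" by simp
    also have "\<dots> \<le> g ^ t * (x * p ^ t)" using mult_mono[OF g5 order_trans[OF C2 that(2)]] G(1) by simp
    finally have "4 * (272 * real t ^ 2) * y \<le> g ^ t * (x * p ^ t) * y" using that by (intro mult_right_mono)
    also have "\<dots> \<le> \<Lambda>" using that(1) by (simp add: r power_mult_distrib mult_ac)
    finally show ?thesis by simp
  qed
  have S0: "0 \<le> SP" "0 \<le> SQ" unfolding SP_def SQ_def P_def Q_def by (intro sum_nonneg; simp)+
  have "272 * real t ^ 2 * SP \<le> \<Lambda> / 4"
    using sum_card_common_nbrs_le_walks[OF ex G(1,2), of r] denseB S0
    by (intro linear[of ?b]) (simp_all add: SP_def P_def \<Lambda>_def p_def)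
  moreover have "272 * real t ^ 2 * SQ \<le> \<Lambda> / 4"
    using sum_card_common_nbrs_le_walks'[OF ex G(1,2), of r] denseA S0
    by (intro linear[of ?a]) (simp_all add: SQ_def Q_def \<Lambda>_def p_def)
  ultimately have main: "\<Lambda> \<le> 256 * real t * main" using upper by linarith
  have "main \<le> (2809 * (m * p)) ^ r * (m * ((2 ^ (r + 3)) ^ 2 * m * p ^ (2 * r + 2)) powr (2/3))"
    using sum_config_powr_le[OF ex, of r] G by (simp add: main_def P_def Q_def m_def p_def r add_ac)
  then have "256 * real t * main
      \<le> 256 * real t * ((2809 * (m * p)) ^ r * (m * ((2 ^ (r + 3)) ^ 2 * m * p ^ (2 * r + 2)) powr (2/3)))"
    by (rule mult_left_mono) simp
  with main have L1: "\<Lambda>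
      \<le> 256 * real t * ((2809 * (m * p)) ^ r * (m * ((2 ^ (r + 3)) ^ 2 * m * p ^ (2 * r + 2)) powr (2/3)))"
    by (rule order_trans)
  \<comment> \<open>The power of \<open>g\<close> in the lower bound for \<open>\<Lambda>\<close> is
    \<open>3 * r + 3 = 3 * (t - 1)\<close>, so at most a factor 27 is lost.\<close>
  have "1/27 \<le> (g ^ (t - 1)) ^ 3" using power_mono[OF G(6), of 3] by (simp add: power3_eq_cube)
  also have "\<dots> = g ^ ((t - 1) * 3)" by (rule power_mult[symmetric])
  also have "(t - 1) * 3 = 3 * r + 3" by (simp add: r)
  finally have "1/27 * (p ^ (3 * r + 3) * m ^ (r + 2)) \<le> g ^ (3 * r + 3) * (p ^ (3 * r + 3) * m ^ (r + 2))"
    using p m by (intro mult_right_mono) auto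
  also have "\<dots> \<le> \<Lambda>"
    using sum_walks_ge[OF ex G(1,2), of r] by (simp add: \<Lambda>_def p_def m_def power_mult_distrib mult_ac)
  also note L1
  finally have L2: "p ^ (3 * r + 3) * m ^ (r + 2)
     \<le> 27 * (256 * real t * ((2809 * (m * p)) ^ r * (m * ((2 ^ (r + 3)) ^ 2 * m * p ^ (2 * r + 2)) powr (2/3))))"
    by simp
  \<comment> \<open>Cubing removes the exponent \<open>2/3\<close>. \<open>K\<close> gathers
    \<open>27^3 = 3^9\<close>, the cube of \<open>256 * t\<close>, the cube of
    \<open>2809^r\<close>, and the fourth power of \<open>2^(r + 3)\<close> from the degree moments,
    where \<open>4 * (r + 3) = 4 * t + 4\<close>.\<close>
  define K where "K = 3 ^ 9 * (256 * real t) ^ 3 * 2809 ^ (3 * r) * 2 ^ (4 * t + 4)"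
  let ?Z = "(2 ^ (r + 3)) ^ 2 * m * p ^ (2 * r + 2)"
  have Z: "(?Z powr (2/3)) ^ 3 = ?Z ^ 2" using p m by (simp add: powr_power)
  have "(p ^ (3 * r + 3) * m ^ (r + 2)) ^ 3
     \<le> (27 * (256 * real t * ((2809 * (m * p)) ^ r * (m * ?Z powr (2/3))))) ^ 3"
    using L2 p m by (intro power_mono) auto
  also have "\<dots> = 27 ^ 3 * (256 * real t) ^ 3 * (2809 * (m * p)) ^ (r * 3) * m ^ 3 * ?Z ^ 2"
  proof -
    have "(k * (x * (q ^ r * (m * z)))) ^ 3 = k ^ 3 * x ^ 3 * q ^ (r * 3) * m ^ 3 * z ^ 3" for k x q z :: real
      by (simp only: power_mult_distrib power_mult mult.assoc)
    then show ?thesis by (simp only: Z)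
  qed
  also have "\<dots> = K * (p ^ (7 * r + 4) * m ^ (3 * r + 5))"
  proof -
    have "(((2::real) ^ (r + 3)) ^ 2) ^ 2 = 2 ^ (4 * t + 4)" by (simp add: r algebra_simps flip: power_mult)
    moreover have "?Z ^ 2 = (((2::real) ^ (r + 3)) ^ 2) ^ 2 * m ^ 2 * p ^ (4 * r + 4)"
    proof -
      have "(p ^ (2 * r + 2)) ^ 2 = p ^ (4 * r + 4)"
        unfolding power_mult[symmetric] by (rule arg_cong[of _ _ "power p"]) simp
      then show ?thesis by (simp only: power_mult_distrib)
    qed
    moreover have "(2809 * (m * p)) ^ (r * 3) = 2809 ^ (3 * r) * m ^ (3 * r) * p ^ (3 * r)"
      by (simp add: power_mult_distrib mult.commute)
    moreover have "p ^ (7 * r + 4) = p ^ (3 * r) * p ^ (4 * r + 4)" "m ^ (3 * r + 5) = m ^ (3 * r) * m ^ 3 * m ^ 2"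
      by (simp_all add: add.commute flip: power_add)
    moreover have "(27::real) ^ 3 = 3 ^ 9" by simp
    ultimately show ?thesis by (simp only: K_def mult_ac)
  qed
  finally have "(p ^ (3 * r + 3) * m ^ (r + 2)) ^ 3 \<le> K * (p ^ (7 * r + 4) * m ^ (3 * r + 5))" .
  \<comment> \<open>The exponents of \<open>p\<close> differ by
    \<open>(9 * r + 9) - (7 * r + 4) = 2 * t + 1\<close>, those of \<open>m\<close> by 1.\<close>
  moreover have "(p ^ (3 * r + 3) * m ^ (r + 2)) ^ 3 = (m * p ^ (2 * t + 1)) * (p ^ (7 * r + 4) * m ^ (3 * r + 5))"
  proof -
    have "p ^ ((3 * r + 3) * 3) = p ^ (2 * t + 1) * p ^ (7 * r + 4)" "m ^ ((r + 2) * 3) = m * m ^ (3 * r + 5)"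
      unfolding power_add[symmetric] power_Suc[symmetric]
      by (rule arg_cong[of _ _ "power p"] arg_cong[of _ _ "power m"]; simp add: r)+
    then show ?thesis by (simp only: power_mult_distrib power_mult[symmetric] mult_ac)
  qed
  ultimately have "m * p ^ (2 * t + 1) \<le> K" using p m by simp
  then have "C ^ (2 * t + 1) \<le> K" using dense by linarith
  moreover have "real (3 ^ 9 * (256 * t) ^ 3 * 2809 ^ (3 * (t - 2)) * 2 ^ (4 * t + 4)) < real ((2 ^ 15 * t) ^ (2 * t + 1))"
    using numeric_bound[OF t] by (simp only: of_nat_less_iff)
  ultimately show False by (simp add: K_def C_def r)
qed

text \<open>By finiteness some pair of nonempty subsets has the largest score
  \<open>e / (|A| |B|)^g\<close>. This is at least the score of the whole graph, hence positive, so
  edges remain.\<close>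

lemma extremal_subgraph_exists:
  assumes fin: "finite A0" "finite B0" and sub: "E0 \<subseteq> A0 \<times> B0" and ne: "E0 \<noteq> {}"
  obtains A B where "A \<subseteq> A0" "B \<subseteq> B0" "extremal g (E0 \<inter> A \<times> B) A B"
    "real (card E0) / (real (card A0) * real (card B0)) powr g
      \<le> real (card (E0 \<inter> A \<times> B)) / (real (card A) * real (card B)) powr g"
proof -
  define S where "S = {W. fst W \<subseteq> A0 \<and> snd W \<subseteq> B0 \<and> fst W \<noteq> {} \<and> snd W \<noteq> {}}"
  define f where "f W = real (card (E0 \<inter> fst W \<times> snd W)) / (real (card (fst W)) * real (card (snd W))) powr g"
    for W :: "'a set \<times> 'b set"
  have "finite S" by (rule finite_subset[of _ "Pow A0 \<times> Pow B0"]) (use fin in \<open>auto simp: S_def mem_Times_iff\<close>)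
  moreover have S0: "(A0, B0) \<in> S" using sub ne by (auto simp: S_def)
  ultimately have "Max (f ` S) \<in> f ` S" and le: "\<And>W. W \<in> S \<Longrightarrow> f W \<le> Max (f ` S)"
    by (auto intro!: Max_in)
  then obtain W where W: "W \<in> S" "f W = Max (f ` S)" by auto
  obtain A B where AB: "W = (A, B)" by (cases W)
  have sAB: "A \<subseteq> A0" "B \<subseteq> B0" "A \<noteq> {}" "B \<noteq> {}" using W by (auto simp: S_def AB)
  have fAB: "finite A" "finite B" using sAB fin finite_subset by auto
  let ?E = "E0 \<inter> A \<times> B"
  have pos: "0 < real (card A)" "0 < real (card B)" using sAB fAB by (auto simp: card_gt_0_iff)
  have max: "f (U, V) \<le> f (A, B)" if "(U, V) \<in> S" for U V using le[OF that] W by (simp add: AB)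
  have E0: "E0 \<inter> A0 \<times> B0 = E0" using sub by auto
  have init: "real (card E0) / (real (card A0) * real (card B0)) powr g
      \<le> real (card ?E) / (real (card A) * real (card B)) powr g"
    using max[OF S0] by (simp add: f_def E0)
  have "finite E0" using fin sub finite_subset by blast
  moreover have "A0 \<noteq> {}" "B0 \<noteq> {}" using ne sub by auto
  ultimately have "0 < card E0" "0 < card A0" "0 < card B0" using ne fin by (simp_all add: card_gt_0_iff)
  then have "0 < real (card E0) / (real (card A0) * real (card B0)) powr g" by simp
  then have "?E \<noteq> {}" using init by auto
  moreover have "real (card (?E \<inter> U \<times> V)) \<le>
      real (card ?E) * (real (card U) / real (card A)) powr g * (real (card V) / real (card B)) powr g"
    if UV: "U \<subseteq> A" "V \<subseteq> B" for U V
  proof (cases "U = {} \<or> V = {}")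
    case True then show ?thesis by auto
  next
    case False
    then have "(U, V) \<in> S" using UV sAB by (auto simp: S_def)
    moreover have "?E \<inter> U \<times> V = E0 \<inter> U \<times> V" using UV by auto
    moreover have "0 < card U" "0 < card V" using False UV fAB by (auto simp: card_gt_0_iff intro: finite_subset)
    ultimately show ?thesis
      using max[of U V] pos by (simp add: f_def powr_divide powr_mult field_simps)
  qed
  ultimately have "extremal g ?E A B" using sAB fAB by (auto simp: extremal_def)
  then show ?thesis using that sAB init by blast
qed

text \<open>With \<open>d = 2 * t + 1\<close> one has \<open>1 - g = 2 / d\<close>. Comparing the
  score of the whole graph with that of the extremal subgraph gives
  \<open>p * (a * b)^(2/d) \<ge> C * N^(2/d)\<close>. Its \<open>d\<close>-th power
  \<open>p^d * (a * b)^2 \<ge> C^d * N^2\<close> yields all three density conditions.\<close>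

lemma has_H_of_dense_bipartite:
  fixes t n :: nat
  assumes t: "2 \<le> t" and fin: "finite A0" "finite B0" and sub: "E0 \<subseteq> A0 \<times> B0"
    and n: "card A0 \<le> n" "card B0 \<le> n"
    and dense: "2 ^ 15 * real t * real n powr (4 * real t / (2 * real t + 1)) < real (card E0)"
  shows "has_H t E0"
proof -
  define g where "g = (2 * real t - 1) / (2 * real t + 1)"
  define C where "C = 2 ^ 15 * real t"
  define d where "d = 2 * real t + 1"
  have t2: "real t \<ge> 2" using t by simp
  have d: "d > 0" "real (2 * t + 1) = d" using t2 by (auto simp: d_def)
  have gd: "1 - g = 2 / d" "0 \<le> g" using t2 by (auto simp: g_def d_def field_simps)
  have C: "C > 0" using t2 by (simp add: C_def)
  have ne: "E0 \<noteq> {}"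
  proof
    assume "E0 = {}"
    then have "2 ^ 15 * real t * real n powr (4 * real t / (2 * real t + 1)) < 0" using dense by simp
    moreover have "0 \<le> 2 ^ 15 * real t * real n powr (4 * real t / (2 * real t + 1))" by simp
    ultimately show False by linarith
  qed
  obtain A B where AB: "A \<subseteq> A0" "B \<subseteq> B0" and ex: "extremal g (E0 \<inter> A \<times> B) A B"
    and score: "real (card E0) / (real (card A0) * real (card B0)) powr g
      \<le> real (card (E0 \<inter> A \<times> B)) / (real (card A) * real (card B)) powr g"
    by (rule extremal_subgraph_exists[OF fin sub ne])
  let ?E = "E0 \<inter> A \<times> B"
  define a b N p where "a = real (card A)" and "b = real (card B)" and "N = real n" and "p = edge_density ?E A B"
  note D = extremalD[OF ex]
  have ab: "0 < a" "0 < b" using D by (auto simp: a_def b_def)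
  have "card A \<le> n" "card B \<le> n" using card_mono[OF fin(1) AB(1)] card_mono[OF fin(2) AB(2)] n by auto
  then have abN: "a \<le> N" "b \<le> N" "0 < N" using ab by (auto simp: a_def b_def N_def)
  have c0: "0 < real (card A0)" "0 < real (card B0)" using ne sub fin by (auto simp: card_gt_0_iff)
  have p: "real (card ?E) = p * (a * b)" using ab by (simp add: p_def edge_density_def a_def b_def)
  have "C * N powr (2 / d) = C * N powr (4 * real t / d) / (N * N) powr g"
  proof -
    have "g = (d - 2) / d" "4 * real t = 2 + 2 * (d - 2)" by (simp_all add: g_def d_def)
    then have "4 * real t / d = 2 / d + (g + g)" by (simp only: add_divide_distrib mult_2)
    then have "N powr (4 * real t / d) = N powr (2 / d) * (N * N) powr g"
      using abN by (simp only: powr_add powr_mult)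
    then show ?thesis using abN by simp
  qed
  also have "\<dots> \<le> real (card E0) / (N * N) powr g"
    using dense by (intro divide_right_mono) (auto simp: C_def N_def d_def)
  also have "\<dots> \<le> real (card E0) / (real (card A0) * real (card B0)) powr g"
    using c0 n gd by (intro divide_left_mono powr_mono2 mult_mono mult_pos_pos) (auto simp: N_def)
  also have "\<dots> \<le> p * (a * b) / (a * b) powr g" using score by (simp only: p a_def b_def)
  also have "\<dots> = p * (a * b) powr (2 / d)"
    using ab by (simp add: powr_diff flip: gd(1))
  finally have "C * N powr (2 / d) \<le> p * (a * b) powr (2 / d)" .
  moreover have p0: "0 \<le> p" by (simp add: p_def edge_density_def)
  ultimately have "(C * N powr (2 / d)) ^ (2 * t + 1) \<le> (p * (a * b) powr (2 / d)) ^ (2 * t + 1)"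
    using C by (intro power_mono) auto
  moreover have root: "(x powr (2 / d)) ^ (2 * t + 1) = x ^ 2" if "0 < x" for x
  proof -
    have "(x powr (2 / d)) ^ (2 * t + 1) = x powr (2 / d * real (2 * t + 1))"
      using that by (simp only: powr_power) simp
    also have "2 / d * real (2 * t + 1) = 2" unfolding d(2) using d(1) by simp
    finally show ?thesis using that by simp
  qed
  ultimately have key: "C ^ (2 * t + 1) * N ^ 2 \<le> p ^ (2 * t + 1) * (a * b) ^ 2"
    using ab abN by (simp only: power_mult_distrib[of C] power_mult_distrib[of p] root mult_pos_pos)
  have one: "C ^ (2 * t + 1) \<le> a * b * p ^ (2 * t + 1)"
  proof -
    have "C ^ (2 * t + 1) * (a * b) \<le> C ^ (2 * t + 1) * N ^ 2"
      unfolding power2_eq_square using C ab abN by (intro mult_left_mono mult_mono) auto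
    also note key
    finally have "C ^ (2 * t + 1) * (a * b) \<le> (a * b * p ^ (2 * t + 1)) * (a * b)"
      by (simp add: power2_eq_square mult_ac)
    then show ?thesis by (rule mult_right_le_imp_le) (use ab in simp)
  qed
  \<comment> \<open>The \<open>t\<close>-th power of \<open>key\<close> contains
    \<open>x^(2 * t)\<close>, which for \<open>x \<ge> 1\<close> is at most
    \<open>x^(2 * t + 1)\<close>, while \<open>y \<le> N\<close> cancels the power of
    \<open>N\<close>. Both sides become \<open>(2 * t + 1)\<close>-th powers. This is the fit for
    which \<open>g\<close> is chosen.\<close>
  have side: "C ^ t \<le> x * p ^ t" if x: "1 \<le> x" "x \<le> N" and y: "0 < y" "y \<le> N" and xy: "a * b = x * y" for x y
  proof -
    have "(C ^ t) ^ (2 * t + 1) * (N ^ 2) ^ t = (C ^ (2 * t + 1) * N ^ 2) ^ t"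
      by (simp add: power_mult_distrib mult.commute flip: power_mult)
    also have "\<dots> \<le> (p ^ (2 * t + 1) * (x * y) ^ 2) ^ t"
      using key C abN unfolding xy by (intro power_mono) auto
    also have "\<dots> = (p ^ t) ^ (2 * t + 1) * x ^ (2 * t) * (y ^ 2) ^ t"
      by (simp add: power_mult_distrib mult.commute flip: power_mult)
    also have "\<dots> \<le> (p ^ t) ^ (2 * t + 1) * x ^ (2 * t + 1) * (N ^ 2) ^ t"
      using p0 x y by (intro mult_mono power_mono power_increasing) auto
    finally have "(C ^ t) ^ (2 * t + 1) \<le> (x * p ^ t) ^ (2 * t + 1)"
      using abN by (simp add: power_mult_distrib mult_ac)
    then show ?thesis
      using power_le_imp_le_base[of "C ^ t" "2 * t" "x * p ^ t"] x p0 by simp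
  qed
  have "1 \<le> a" "1 \<le> b" using D by (auto simp: a_def b_def)
  then have "C ^ t \<le> a * p ^ t" "C ^ t \<le> b * p ^ t"
    using side[of a b] side[of b a] ab abN by (auto simp: mult.commute)
  then have "has_H t ?E"
    using has_H_of_extremal[OF t g_def ex] one by (simp add: C_def a_def b_def p_def mult_ac)
  then show ?thesis unfolding has_H_def by blast
qed

section \<open>Reduction to bipartite graphs\<close>

text \<open>Vertices are inserted one at a time, each on the side opposite to the majority of its
  earlier neighbours, so at least half of the new edges cross. Edges of the cut are oriented from
  \<open>W\<close> outwards, which makes the cut a relation between disjoint sets.\<close>

lemma large_cut_exists:
  assumes "finite V" "\<And>e. e \<in> E \<Longrightarrow> e \<subseteq> V \<and> card e = 2"
  shows "\<exists>W\<subseteq>V. card E \<le> 2 * card {(u, v) \<in> W \<times> (V - W). {u, v} \<in> E}"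
  using assms
proof (induction V arbitrary: E)
  case empty
  then have "E = {}" by force
  then show ?case by auto
next
  case (insert x V)
  define E' where "E' = {e\<in>E. x \<notin> e}"
  define N where "N = {y\<in>V. {x, y} \<in> E}"
  have prems': "e \<subseteq> V \<and> card e = 2" if "e \<in> E'" for e
    using insert.prems[of e] that by (auto simp: E'_def)
  obtain W where W: "W \<subseteq> V" "card E' \<le> 2 * card {(u, v) \<in> W \<times> (V - W). {u, v} \<in> E'}"
    using insert.IH[OF prems'] by blast
  let ?K = "{(u, v) \<in> W \<times> (V - W). {u, v} \<in> E'}"
  have finW: "finite W" "finite N" "finite E'" "finite ?K"
  proof -
    show "finite W" "finite N" using W insert.hyps finite_subset by (auto simp: N_def)
    have "E' \<subseteq> Pow V" using insert.prems by (auto simp: E'_def)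
    then show "finite E'" using insert.hyps by (meson finite_Pow_iff finite_subset)
    show "finite ?K" by (rule finite_subset[of _ "V \<times> V"]) (use W(1) insert.hyps in auto)
  qed
  have "E \<subseteq> E' \<union> (\<lambda>y. {x, y}) ` N"
  proof
    fix e assume e: "e \<in> E"
    show "e \<in> E' \<union> (\<lambda>y. {x, y}) ` N"
    proof (cases "x \<in> e")
      case True
      then obtain y where "e = {x, y}" "y \<noteq> x"
        using insert.prems[OF e] by (auto simp: card_2_iff)
      then show ?thesis using insert.prems[OF e] e by (auto simp: N_def)
    qed (use e in \<open>auto simp: E'_def\<close>)
  qed
  then have "card E \<le> card (E' \<union> (\<lambda>y. {x, y}) ` N)" using finW by (intro card_mono) auto
  also have "\<dots> \<le> card E' + card N"
    using card_Un_le[of E' "(\<lambda>y. {x, y}) ` N"] card_image_le[OF finW(2), of "\<lambda>y. {x, y}"] by linarith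
  finally have cE: "card E \<le> card E' + card N" .
  have cN: "card N = card (N \<inter> W) + card (N - W)"
    using finW by (metis card_Int_Diff)
  have step: "\<exists>W'\<subseteq>insert x V. card E \<le> 2 * card {(u, v) \<in> W' \<times> (insert x V - W'). {u, v} \<in> E}"
    if W': "W' \<subseteq> insert x V" and Z: "?K \<union> Z \<subseteq> {(u, v) \<in> W' \<times> (insert x V - W'). {u, v} \<in> E}"
      "?K \<inter> Z = {}" "card N \<le> 2 * card Z" "finite Z" for W' Z
  proof -
    have "card ?K + card Z = card (?K \<union> Z)" using Z finW by (simp add: card_Un_disjoint)
    also have "\<dots> \<le> card {(u, v) \<in> W' \<times> (insert x V - W'). {u, v} \<in> E}"
      by (rule card_mono[OF _ Z(1)], rule finite_subset[of _ "insert x V \<times> insert x V"])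
         (use W' insert.hyps in auto)
    finally show ?thesis using W' cE W(2) Z(3) by (intro exI[of _ W']) linarith
  qed
  have xW: "x \<notin> W" "x \<notin> N" using W(1) insert.hyps by (auto simp: N_def)
  show ?case
  proof (cases "card (N - W) \<le> card (N \<inter> W)")
    case True
    show ?thesis
    proof (rule step[of W "(N \<inter> W) \<times> {x}"])
      show "?K \<union> (N \<inter> W) \<times> {x} \<subseteq> {(u, v) \<in> W \<times> (insert x V - W). {u, v} \<in> E}"
        using xW by (auto simp: N_def E'_def insert_commute)
      show "?K \<inter> (N \<inter> W) \<times> {x} = {}" using insert.hyps by auto
      show "card N \<le> 2 * card ((N \<inter> W) \<times> {x})" using True cN by (simp add: card_cartesian_product)
    qed (use W(1) finW(1,2) in auto)
  next
    case False
    show ?thesis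
    proof (rule step[of "insert x W" "{x} \<times> (N - W)"])
      have "N \<subseteq> V" by (auto simp: N_def)
      then show "?K \<union> {x} \<times> (N - W) \<subseteq> {(u, v) \<in> insert x W \<times> (insert x V - insert x W). {u, v} \<in> E}"
        using xW insert.hyps by (auto simp: N_def E'_def)
      show "?K \<inter> {x} \<times> (N - W) = {}" using xW by auto
      show "card N \<le> 2 * card ({x} \<times> (N - W))" using False cN by (simp add: card_cartesian_product)
    qed (use W(1) finW(1,2) in auto)
  qed
qed

text \<open>The copy is the image of \<open>H\<close> itself and not the subgraph induced on its
  vertices, so \<open>\<phi>\<close> may send non-edges of \<open>H\<close> to edges of
  \<open>G\<close>.\<close>

lemma contains_copyI:
  assumes H: "simple_graph H" and inj: "inj_on \<phi> (verts H)" and sub: "\<phi> ` verts H \<subseteq> verts G"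
    and edges: "\<And>e. e \<in> edges H \<Longrightarrow> \<phi> ` e \<in> edges G"
  shows "contains_copy G H"
proof -
  let ?F = "(\<phi> ` verts H, (`) \<phi> ` edges H)"
  have e: "e \<subseteq> verts H" "card e = 2" if "e \<in> edges H" for e using H that by (auto simp: simple_graph_def)
  have "simple_graph ?F"
    using H e by (auto simp: simple_graph_def card_image[OF inj_on_subset[OF inj]])
  then have "subgraph ?F G" using sub edges by (auto simp: subgraph_def)
  moreover have "graph_iso ?F H"
    unfolding graph_iso_def
  proof (intro exI[of _ "inv_into (verts H) \<phi>"] conjI ballI)
    show "bij_betw (inv_into (verts H) \<phi>) (verts ?F) (verts H)"
      using inj by (simp add: bij_betw_inv_into inj_on_imp_bij_betw)
    fix u v assume "u \<in> verts ?F" "v \<in> verts ?F"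
    then obtain x y where xy: "x \<in> verts H" "y \<in> verts H" "u = \<phi> x" "v = \<phi> y" by auto
    have "{\<phi> x, \<phi> y} \<in> (`) \<phi> ` edges H \<longleftrightarrow> {x, y} \<in> edges H"
    proof
      assume "{\<phi> x, \<phi> y} \<in> (`) \<phi> ` edges H"
      then obtain e' where "e' \<in> edges H" "\<phi> ` {x, y} = \<phi> ` e'" by auto
      then show "{x, y} \<in> edges H"
        using inj_on_image_eq_iff[OF inj, of "{x, y}" e'] e xy by auto
    qed (use imageI[of "{x, y}" "edges H" "image \<phi>"] in simp)
    then show "{u, v} \<in> edges ?F \<longleftrightarrow> {inv_into (verts H) \<phi> u, inv_into (verts H) \<phi> v} \<in> edges H"
      using xy inj by simp
  qed
  ultimately show ?thesis unfolding contains_copy_def by blast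
qed

lemma contains_copy_H_graph:
  assumes H: "has_H t E" and disj: "A \<inter> B = {}" and sub: "E \<subseteq> A \<times> B" "A \<subseteq> verts G" "B \<subseteq> verts G"
    and E: "\<And>u v. (u, v) \<in> E \<Longrightarrow> {u, v} \<in> edges G"
  shows "contains_copy G (H_graph t t)"
proof -
  obtain es fs where l: "length es = t" "length fs = t" and mem: "set es \<subseteq> E" "set fs \<subseteq> E"
    and d1: "distinct (map fst es @ map fst fs)" and d2: "distinct (map snd es @ map snd fs)"
    and adj: "\<And>e f. e \<in> set es \<Longrightarrow> f \<in> set fs \<Longrightarrow> (fst e, snd f) \<in> E \<and> (fst f, snd e) \<in> E"
    using H unfolding has_H_def by blast
  \<comment> \<open>Of the two colour classes of \<open>H\<close>, the vertices \<open>X\<close>,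
    \<open>Y'\<close> go to \<open>A\<close> and \<open>Y\<close>, \<open>X'\<close> go to
    \<open>B\<close>. Vertices are numbered from 1, list positions from 0.\<close>
  define \<phi> where "\<phi> w = (case w of X i \<Rightarrow> fst (es ! (i - 1)) | Y i \<Rightarrow> snd (es ! (i - 1))
     | X' j \<Rightarrow> snd (fs ! (j - 1)) | Y' j \<Rightarrow> fst (fs ! (j - 1)))" for w
  have es: "es ! (i - 1) \<in> set es" "es ! (i - 1) \<in> E" "fst (es ! (i - 1)) \<in> A" "snd (es ! (i - 1)) \<in> B"
    and fs: "fs ! (i - 1) \<in> set fs" "fs ! (i - 1) \<in> E" "fst (fs ! (i - 1)) \<in> A" "snd (fs ! (i - 1)) \<in> B"
    if "i \<in> {1..t}" for i
  proof -
    show 1: "es ! (i - 1) \<in> set es" "fs ! (i - 1) \<in> set fs" using that l by (auto intro!: nth_mem)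
    then show 2: "es ! (i - 1) \<in> E" "fs ! (i - 1) \<in> E" using mem by auto
    show "fst (es ! (i - 1)) \<in> A" "snd (es ! (i - 1)) \<in> B" "fst (fs ! (i - 1)) \<in> A" "snd (fs ! (i - 1)) \<in> B"
      using 2 sub(1) by auto
  qed
  have ne: "fst (es ! (i - 1)) \<noteq> fst (fs ! (j - 1))" "snd (es ! (i - 1)) \<noteq> snd (fs ! (j - 1))"
    if "i \<in> {1..t}" "j \<in> {1..t}" for i j
    using es(1)[OF that(1)] fs(1)[OF that(2)] d1 d2 by auto
  have eq: "fst (es ! (i - 1)) = fst (es ! (j - 1)) \<longleftrightarrow> i = j" "snd (es ! (i - 1)) = snd (es ! (j - 1)) \<longleftrightarrow> i = j"
    "fst (fs ! (i - 1)) = fst (fs ! (j - 1)) \<longleftrightarrow> i = j" "snd (fs ! (i - 1)) = snd (fs ! (j - 1)) \<longleftrightarrow> i = j"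
    if "i \<in> {1..t}" "j \<in> {1..t}" for i j
  proof -
    have *: "zs ! (i - 1) = zs ! (j - 1) \<longleftrightarrow> i = j" if "distinct zs" "length zs = t" for zs :: "'c list"
      using that \<open>i \<in> {1..t}\<close> \<open>j \<in> {1..t}\<close> by (auto simp: nth_eq_iff_index_eq)
    have "i - 1 < t" "j - 1 < t" using that by auto
    then show "fst (es ! (i - 1)) = fst (es ! (j - 1)) \<longleftrightarrow> i = j" "snd (es ! (i - 1)) = snd (es ! (j - 1)) \<longleftrightarrow> i = j"
      "fst (fs ! (i - 1)) = fst (fs ! (j - 1)) \<longleftrightarrow> i = j" "snd (fs ! (i - 1)) = snd (fs ! (j - 1)) \<longleftrightarrow> i = j"
      using *[of "map fst es"] *[of "map snd es"] *[of "map fst fs"] *[of "map snd fs"] d1 d2 l by simp_all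
  qed
  have AB: "x \<noteq> y" if "x \<in> A" "y \<in> B" for x y using disj that by auto
  have "inj_on \<phi> (verts (H_graph t t))"
  proof (rule inj_onI)
    fix w w' assume w: "w \<in> verts (H_graph t t)" "w' \<in> verts (H_graph t t)" and e: "\<phi> w = \<phi> w'"
    obtain i where i: "i \<in> {1..t}" "w = X i \<or> w = Y i \<or> w = X' i \<or> w = Y' i"
      using w(1) unfolding H_graph_def by auto
    obtain j where j: "j \<in> {1..t}" "w' = X j \<or> w' = Y j \<or> w' = X' j \<or> w' = Y' j"
      using w(2) unfolding H_graph_def by auto
    \<comment> \<open>Vertices of one colour class are separated by distinctness of the lists,
      vertices of different classes by disjointness of \<open>A\<close> and
      \<open>B\<close>.\<close>
    note same = eq[OF i(1) j(1)] ne[OF i(1) j(1)] ne[OF j(1) i(1)]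
    note diff = AB[OF es(3)[OF i(1)] es(4)[OF j(1)]] AB[OF es(3)[OF i(1)] fs(4)[OF j(1)]]
      AB[OF fs(3)[OF i(1)] es(4)[OF j(1)]] AB[OF fs(3)[OF i(1)] fs(4)[OF j(1)]]
      AB[OF es(3)[OF j(1)] es(4)[OF i(1)]] AB[OF es(3)[OF j(1)] fs(4)[OF i(1)]]
      AB[OF fs(3)[OF j(1)] es(4)[OF i(1)]] AB[OF fs(3)[OF j(1)] fs(4)[OF i(1)]]
    show "w = w'"
      using i(2) j(2) e same diff by (elim disjE) (simp_all add: \<phi>_def)
  qed
  moreover have "\<phi> ` verts (H_graph t t) \<subseteq> verts G"
    using es fs sub by (auto simp: H_graph_def \<phi>_def)
  moreover have "\<phi> ` e \<in> edges G" if "e \<in> edges (H_graph t t)" for e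
  proof -
    have "{\<phi> (X i), \<phi> (Y i)} \<in> edges G" "{\<phi> (X' i), \<phi> (Y' i)} \<in> edges G" if "i \<in> {1..t}" for i
      using E[of "fst (es ! (i - 1))" "snd (es ! (i - 1))"] E[of "fst (fs ! (i - 1))" "snd (fs ! (i - 1))"]
        es(2)[OF that] fs(2)[OF that] by (simp_all add: \<phi>_def insert_commute)
    moreover have "{\<phi> (X i), \<phi> (X' j)} \<in> edges G" "{\<phi> (Y i), \<phi> (Y' j)} \<in> edges G"
      if "i \<in> {1..t}" "j \<in> {1..t}" for i j
      using adj[OF es(1)[OF that(1)] fs(1)[OF that(2)]] E by (simp_all add: \<phi>_def insert_commute)
    ultimately show ?thesis using that by (auto simp: H_graph_def)
  qed
  ultimately show ?thesis by (rule contains_copyI[OF simple_graph_H_graph])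
qed

theorem theorem6p2:
  fixes t :: nat
  assumes "t \<ge> 2"
  shows "\<forall>\<^sub>F n in sequentially.
    real (ex_number n (H_graph t t)) \<le> 2 ^ 16 * real t * real n powr (4 * real t / (2 * real t + 1))"
proof (rule always_eventually, rule allI)
  fix n :: nat
  let ?b = "real n powr (4 * real t / (2 * real t + 1))"
  have "\<exists>i. {X 1, Y 1} = {X i, Y i} \<and> i \<in> {1..t}" using assms by (intro exI[of _ 1]) simp
  then have "edges (H_graph t t) \<noteq> {}" unfolding H_graph_def snd_conv by blast
  then have "ex_set n (H_graph t t) \<noteq> {}" by (rule ex_set_nonempty[OF simple_graph_H_graph])
  then have "ex_number n (H_graph t t) \<in> ex_set n (H_graph t t)"
    unfolding ex_number_def by (rule Max_in[OF finite_ex_set])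
  then obtain G :: "nat graph" where ex: "ex_number n (H_graph t t) = card (edges G)"
    and G: "simple_graph G" "card (verts G) = n" "\<not> contains_copy G (H_graph t t)"
    unfolding ex_set_def mem_Collect_eq by blast
  have fin: "finite (verts G)" and e: "\<And>e. e \<in> edges G \<Longrightarrow> e \<subseteq> verts G \<and> card e = 2"
    using G(1) by (auto simp: simple_graph_def)
  \<comment> \<open>Passing to a cut costs a factor 2, the difference between \<open>2 ^ 16\<close>
    and the constant \<open>2 ^ 15\<close> of the bipartite bound.\<close>
  obtain W where W: "W \<subseteq> verts G"
    "card (edges G) \<le> 2 * card {(u, v) \<in> W \<times> (verts G - W). {u, v} \<in> edges G}"
    using large_cut_exists[OF fin e] by blast
  let ?E = "{(u, v) \<in> W \<times> (verts G - W). {u, v} \<in> edges G}"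
  have finW: "finite W" by (rule finite_subset[OF W(1) fin])
  show "real (ex_number n (H_graph t t)) \<le> 2 ^ 16 * real t * ?b"
  proof (rule ccontr)
    assume "\<not> ?thesis"
    then have "2 ^ 15 * real t * ?b < real (card ?E)" using W(2) ex by simp
    moreover have "card W \<le> n" "card (verts G - W) \<le> n"
      using W(1) fin G(2) by (auto intro: card_mono)
    ultimately have "has_H t ?E"
      using finW fin by (intro has_H_of_dense_bipartite[OF assms, of W "verts G - W" _ n]) auto
    then have "contains_copy G (H_graph t t)"
      by (rule contains_copy_H_graph[of _ _ W "verts G - W"]) (use W in auto)
    then show False using G(3) by simp
  qed
qed

end
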